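(* Let $\boldsymbol p=(p_1,p_2,p_3)$ and $\boldsymbol n=(n_1,n_2,n_3)$ be integer triples with $p_i\ge1$ and $n_i\ge p_i+1$, and let $r_i=\min\{p_i,2(n_i-p_i)\}$. Let $$\widehat Z^{0}=\{z\in\mathbb Q_{\boldsymbol p}^3:\ \mathcal T(z;u,v)=0\ \text{ for all }u,v\in\mathbb Q_{\boldsymbol p}^3\},$$ where $\mathcal T(z;u,v)=\mathcal G_{\boldsymbol n}[Dz:(Du\times Dv)]-\int_{[-1,1]^3}Dz:(Du\times Dv)\,d\xi$. (i) If at least two of the orders satisfy $p_i\ge2$, then $\widehat Z^{0}=\mathbb Q_{(r_1,r_2,r_3)}^3$. (ii) If exactly one coordinate has order greater than one, permute the coordinates $(x,y,z)$ so that $\boldsymbol p=(p,1,1)$ with $p\ge2$, and put $r=\min\{p,2(n_1-p)\}$. Then $\widehat Z^{0}=\mathcal K_{p,n_1}^{3}$ (each component in $\mathcal K_{p,n_1}$), where $$\mathcal K_{p,n_1}=\mathbb P_r(x)\operatorname{span}\{1,y,z\}\ \oplus\ \mathbb P_{\min(p,r+1)}(x)\,yz .$$ (iii) If $p_1=p_2=p_3=1$, then $\widehat Z^{0}=\mathbb Q_{\boldsymbol p}^3$.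
   Context: $\mathbb Q_{\boldsymbol p}$ is the space of real polynomials on $[-1,1]^3$ of degree at most $p_i$ in the $i$-th coordinate; $\mathbb Q_{\boldsymbol p}^3$ denotes vector fields with all three components in it. $\mathbb P_j(x)$ is the space of univariate polynomials in $x$ of degree at most $j$. $\mathcal G_{\boldsymbol n}$ is the tensor-product Gauss--Legendre rule with $n_i$ points in the $i$-th coordinate. $Dz$ is the Jacobian matrix (rows: components, columns: coordinates). For $A,B\in\mathbb R^{3\times3}$: $A:B=\operatorname{tr}(A^TB)$; $\operatorname{cof}A$ is the matrix of signed $2\times2$ minors; $A\times B=\operatorname{cof}(A+B)-\operatorname{cof}A-\operatorname{cof}B$. *)

theory Defs
  imports
    "HOL-Analysis.Analysis"
    "HOL-Computational_Algebra.Polynomial"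
begin

(* Polynomials on the cube [-1,1]^3 are represented by the polynomial functions on real^3 that
   extend them; a polynomial is determined by its values on the cube. *)

definition Q_space :: "nat ^ 3 \<Rightarrow> (real ^ 3 \<Rightarrow> real) set" where
  "Q_space p = {f. \<exists>c :: nat \<Rightarrow> nat \<Rightarrow> nat \<Rightarrow> real. \<forall>x. f x =
     (\<Sum>a\<le>p $ 1. \<Sum>b\<le>p $ 2. \<Sum>d\<le>p $ 3. c a b d * x $ 1 ^ a * x $ 2 ^ b * x $ 3 ^ d)}"

definition fields_in :: "(real ^ 3 \<Rightarrow> real) set \<Rightarrow> (real ^ 3 \<Rightarrow> real ^ 3) set" where
  "fields_in V = {z. \<forall>i. (\<lambda>x. z x $ i) \<in> V}"


(* Rodrigues' formula. *)

definition legendre_poly :: "nat \<Rightarrow> real poly" where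
  "legendre_poly n = smult (1 / (2 ^ n * fact n)) ((pderiv ^^ n) ([:-1, 0, 1:] ^ n))"

definition gauss_nodes :: "nat \<Rightarrow> real set" where
  "gauss_nodes n = {x. poly (legendre_poly n) x = 0}"

(* The interpolatory weight: the integral of the Lagrange basis polynomial of the node. *)

definition gauss_weight :: "nat \<Rightarrow> real \<Rightarrow> real" where
  "gauss_weight n x = integral {-1..1} (\<lambda>t. \<Prod>y\<in>gauss_nodes n - {x}. (t - y) / (x - y))"

definition gauss_rule :: "nat ^ 3 \<Rightarrow> (real ^ 3 \<Rightarrow> real) \<Rightarrow> real" where
  "gauss_rule n f =
     (\<Sum>a\<in>gauss_nodes (n $ 1). \<Sum>b\<in>gauss_nodes (n $ 2). \<Sum>c\<in>gauss_nodes (n $ 3).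
        gauss_weight (n $ 1) a * gauss_weight (n $ 2) b * gauss_weight (n $ 3) c
          * f (vector [a, b, c]))"


definition frobenius :: "real ^ 3 ^ 3 \<Rightarrow> real ^ 3 ^ 3 \<Rightarrow> real" where
  "frobenius A B = trace (transpose A ** B)"

definition cof :: "real ^ 3 ^ 3 \<Rightarrow> real ^ 3 ^ 3" where
  "cof A = vector
     [vector [  A $ 2 $ 2 * A $ 3 $ 3 - A $ 2 $ 3 * A $ 3 $ 2,
              - (A $ 2 $ 1 * A $ 3 $ 3 - A $ 2 $ 3 * A $ 3 $ 1),
                A $ 2 $ 1 * A $ 3 $ 2 - A $ 2 $ 2 * A $ 3 $ 1],
      vector [- (A $ 1 $ 2 * A $ 3 $ 3 - A $ 1 $ 3 * A $ 3 $ 2),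
                A $ 1 $ 1 * A $ 3 $ 3 - A $ 1 $ 3 * A $ 3 $ 1,
              - (A $ 1 $ 1 * A $ 3 $ 2 - A $ 1 $ 2 * A $ 3 $ 1)],
      vector [  A $ 1 $ 2 * A $ 2 $ 3 - A $ 1 $ 3 * A $ 2 $ 2,
              - (A $ 1 $ 1 * A $ 2 $ 3 - A $ 1 $ 3 * A $ 2 $ 1),
                A $ 1 $ 1 * A $ 2 $ 2 - A $ 1 $ 2 * A $ 2 $ 1]]"

definition matrix_cross :: "real ^ 3 ^ 3 \<Rightarrow> real ^ 3 ^ 3 \<Rightarrow> real ^ 3 ^ 3" where
  "matrix_cross A B = cof (A + B) - cof A - cof B"


definition cof_integrand ::
    "(real ^ 3 \<Rightarrow> real ^ 3) \<Rightarrow> (real ^ 3 \<Rightarrow> real ^ 3) \<Rightarrow> (real ^ 3 \<Rightarrow> real ^ 3) \<Rightarrow> real ^ 3 \<Rightarrow> real" where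
  "cof_integrand z u v x =
     frobenius (jacobian z (at x)) (matrix_cross (jacobian u (at x)) (jacobian v (at x)))"

definition quadrature_defect ::
    "nat ^ 3 \<Rightarrow> (real ^ 3 \<Rightarrow> real ^ 3) \<Rightarrow> (real ^ 3 \<Rightarrow> real ^ 3) \<Rightarrow> (real ^ 3 \<Rightarrow> real ^ 3) \<Rightarrow> real" where
  "quadrature_defect n z u v =
     gauss_rule n (cof_integrand z u v) - integral (cbox (- 1) 1) (cof_integrand z u v)"

definition Z0_space :: "nat ^ 3 \<Rightarrow> nat ^ 3 \<Rightarrow> (real ^ 3 \<Rightarrow> real ^ 3) set" where
  "Z0_space p n = {z \<in> fields_in (Q_space p).
     \<forall>u\<in>fields_in (Q_space p). \<forall>v\<in>fields_in (Q_space p). quadrature_defect n z u v = 0}"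


(* The two summands of K, where (i, j, k) are the indices of the coordinates (x, y, z):
   P_r(x) span{1, y, z} and P_m(x) yz. *)

definition K_affine :: "3 \<Rightarrow> 3 \<Rightarrow> 3 \<Rightarrow> nat \<Rightarrow> (real ^ 3 \<Rightarrow> real) set" where
  "K_affine i j k r = {f. \<exists>a b c :: real poly. degree a \<le> r \<and> degree b \<le> r \<and> degree c \<le> r \<and>
     (\<forall>x. f x = poly a (x $ i) + poly b (x $ i) * x $ j + poly c (x $ i) * x $ k)}"

definition K_bilinear :: "3 \<Rightarrow> 3 \<Rightarrow> 3 \<Rightarrow> nat \<Rightarrow> (real ^ 3 \<Rightarrow> real) set" where
  "K_bilinear i j k m = {f. \<exists>d :: real poly. degree d \<le> m \<and>
     (\<forall>x. f x = poly d (x $ i) * (x $ j * x $ k))}"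

definition K_space :: "3 \<Rightarrow> 3 \<Rightarrow> 3 \<Rightarrow> nat \<Rightarrow> nat \<Rightarrow> (real ^ 3 \<Rightarrow> real) set" where
  "K_space i j k q m = (let r = min q (2 * (m - q)) in
     {\<lambda>x. f x + g x | f g. f \<in> K_affine i j k r \<and> g \<in> K_bilinear i j k (min q (r + 1))})"

end

theory Submission
  imports Defs
begin

text \<open>Testing with fields having a single nonzero component reduces the claim to scalar polynomials
  \<open>f\<close> for which the rule integrates all \<open>det (grad f, grad g, grad h)\<close> exactly. On monomials with
  exponents \<open>e1\<close>, \<open>e2\<close>, \<open>e3\<close> this determinant is \<open>det (e1, e2, e3)\<close> times the monomial with exponent
  \<open>e1 + e2 + e3 - 1\<close>. In each direction the rule is exact up to degree \<open>2 n - 1\<close>, but not in degree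
  \<open>2 n\<close>, which gives one inclusion at once.

  For the other one let \<open>s\<close> be the degree of \<open>f\<close> in a direction \<open>x\<close>, where \<open>s > 2 (n - p)\<close>, and let
  \<open>\<phi>(y, z)\<close> be the coefficient of \<open>x^s\<close>. Test functions \<open>x^a A(y)\<close> and \<open>x^b B(y) C(z)\<close> with
  \<open>a + b + s = 2 n + 1\<close> only see \<open>\<phi>\<close>. With \<open>m = \<integral> \<phi> C' dz\<close> and \<open>k = \<integral> \<phi>_z C dz\<close> they give
  \<open>\<integral> s m A' B - a A B m' + k (a A B' - b A' B) dy = 0\<close>. If the order in \<open>y\<close> is at least two, this
  forces \<open>m = k = 0\<close>, and then \<open>\<phi> = 0\<close>. If both other orders are one, the finitely many test
  functions leave only \<open>\<phi> = y z\<close>, and that only for \<open>a = b\<close>, which is the case \<open>s = 2 (n - p) + 1\<close>.\<close>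

subsection \<open>Gauss-Legendre quadrature in one variable\<close>

definition pint :: "real poly \<Rightarrow> real" where
  "pint q = integral {-1..1} (poly q)"

lemma pint_eqI: "(\<And>t. poly q t = f t) \<Longrightarrow> pint q = integral {-1..1} f"
proof -
  assume "\<And>t. poly q t = f t"
  then have "poly q = f" by (rule ext)
  then show ?thesis by (simp add: pint_def)
qed

lemma poly_integrable: "poly q integrable_on {-1..1::real}"
  by (intro integrable_continuous_interval continuous_intros)

lemma pint_0 [simp]: "pint 0 = 0"
  using pint_eqI[of 0 "\<lambda>_. 0"] by simp

lemma pint_add: "pint (p + q) = pint p + pint q"
  unfolding pint_def poly_add by (intro integral_add poly_integrable)

lemma pint_smult: "pint (smult c q) = c * pint q"
  unfolding pint_def poly_smult by simp

lemma pint_uminus: "pint (- q) = - pint q"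
  using pint_smult[of "-1" q] by simp

lemma pint_diff: "pint (p - q) = pint p - pint q"
  using pint_add[of p "- q"] by (simp add: pint_uminus)

lemma pint_sum: "pint (\<Sum>a\<in>A. f a) = (\<Sum>a\<in>A. pint (f a))"
  by (induction A rule: infinite_finite_induct) (simp_all add: pint_add)

lemma pint_pderiv: "pint (pderiv q) = poly q 1 - poly q (-1)"
proof -
  have "(poly (pderiv q) has_integral (poly q 1 - poly q (-1))) {-1..1}"
    by (rule fundamental_theorem_of_calculus)
       (auto simp: has_real_derivative_iff_has_vector_derivative[symmetric]
             intro!: derivative_eq_intros poly_DERIV[THEN DERIV_subset])
  then show ?thesis
    unfolding pint_def by (rule integral_unique)
qed

text \<open>A continuous nonnegative integrand with integral 0 vanishes on the whole interval, and
  only the zero polynomial has infinitely many roots.\<close>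

lemma pint_nonneg_eq_0:
  assumes "\<And>x. 0 \<le> poly q x" "pint q = 0"
  shows "q = 0"
proof (rule ccontr)
  assume "q \<noteq> 0"
  then have "finite {x. poly q x = 0}"
    by (rule poly_roots_finite)
  moreover have "{-1<..<1} \<subseteq> {x. poly q x = 0}"
  proof
    fix x :: real
    assume x: "x \<in> {-1<..<1}"
    have "(poly q has_integral 0) (cbox (-1) 1)"
      using assms(2) poly_integrable[of q] unfolding pint_def by (auto simp: has_integral_integral cbox_interval)
    then have "poly q x = 0"
      by (rule has_integral_0_cbox_imp_0[rotated 2]) (use x assms(1) in \<open>auto intro!: continuous_intros\<close>)
    then show "x \<in> {x. poly q x = 0}"
      by simp
  qed
  ultimately show False
    using finite_subset[of "{-1<..<1::real}"] infinite_Ioo[of "-1::real" 1] by auto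
qed

text \<open>Expanding one factor of \<open>q * q\<close> into monomials makes the integral of the
  square vanish. Later this turns identities between moments into identities between
  polynomials.\<close>

lemma pint_orthogonal_imp_0:
  assumes "degree q \<le> n" "\<And>j. j \<le> n \<Longrightarrow> pint (q * monom 1 j) = 0"
  shows "q = 0"
proof -
  have "q * q = (\<Sum>j\<le>n. smult (coeff q j) (q * monom 1 j))"
    by (subst (2) poly_as_sum_of_monoms'[OF assms(1), symmetric])
       (simp add: sum_distrib_left smult_monom flip: mult_smult_right)
  then have "pint (q * q) = 0"
    by (simp add: pint_sum pint_smult assms(2))
  then have "q * q = 0"
    by (rule pint_nonneg_eq_0[rotated]) simp
  then show ?thesis by simp
qed

section \<open>Moments of the monomials\<close>

definition moment :: "nat \<Rightarrow> real" where
  "moment m = integral {-1..1} (\<lambda>t. t ^ m)"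

lemma moment_pint: "moment m = pint (monom 1 m)"
  unfolding moment_def by (rule pint_eqI[symmetric]) (simp add: poly_monom)

lemma moment_eq: "moment m = (1 - (-1) ^ Suc m) / Suc m"
proof -
  have "pderiv (smult (1 / Suc m) (monom 1 (Suc m))) = (monom 1 m :: real poly)"
    by (simp add: pderiv_monom pderiv_smult smult_monom)
  then have "pint (monom 1 m) = poly (smult (1 / Suc m) (monom 1 (Suc m))) 1
      - poly (smult (1 / Suc m) (monom 1 (Suc m))) (-1 :: real)"
    by (metis pint_pderiv)
  then show ?thesis
    by (simp add: moment_pint poly_monom field_simps)
qed

lemma moment_odd: "odd m \<Longrightarrow> moment m = 0"
  by (simp add: moment_eq)

lemma moment_even: "even m \<Longrightarrow> moment m = 2 / Suc m"
  by (simp add: moment_eq)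

section \<open>Legendre polynomials and their orthogonality\<close>

lemma legendre_degree: "degree (legendre_poly n) = n"
  unfolding legendre_poly_def by (simp add: degree_higher_pderiv degree_power_eq)

lemma legendre_nonzero: "legendre_poly n \<noteq> 0"
proof (cases "n = 0")
  case False
  then show ?thesis using legendre_degree[of n] by auto
qed (simp add: legendre_poly_def)

text \<open>Each differentiation takes away at most one factor \<open>q\<close>. For q = x^2 - 1
  this removes the boundary terms when integrating by parts.\<close>

lemma power_dvd_higher_pderiv:
  fixes q :: "real poly"
  shows "k \<le> n \<Longrightarrow> q ^ (n - k) dvd (pderiv ^^ k) (q ^ n)"
proof (induction k)
  case (Suc k)
  then obtain d where d: "(pderiv ^^ k) (q ^ n) = q ^ (n - k) * d"
    by (auto simp: dvd_def)
  have nk: "n - k = Suc (n - Suc k)"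
    using Suc by simp
  have "(pderiv ^^ Suc k) (q ^ n)
      = q ^ (n - Suc k) * (q * pderiv d + d * smult (of_nat (n - k)) (pderiv q))"
    unfolding funpow.simps o_def d nk pderiv_mult pderiv_power_Suc
    by (simp add: algebra_simps)
  then show ?case by simp
qed simp

text \<open>Repeated integration by parts: each step moves one derivative onto \<open>q\<close>, and
  the derivatives of (x^2 - 1)^n of order below n vanish at both end points.\<close>

lemma higher_pderiv_orthogonal:
  fixes q :: "real poly"
  assumes "k \<le> n" "degree q < k"
  shows "pint ((pderiv ^^ k) ([:-1, 0, 1:] ^ n) * q) = 0"
  using assms
proof (induction k arbitrary: q)
  case (Suc k)
  define F where "F = (pderiv ^^ k) ([:-1, 0, 1:] ^ n :: real poly)"
  have "[:-1, 0, 1:] ^ (n - k) dvd F"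
    unfolding F_def by (rule power_dvd_higher_pderiv) (use Suc in simp)
  moreover have "([:-1, 0, 1:] :: real poly) dvd [:-1, 0, 1:] ^ (n - k)"
    by (rule dvd_power) (use Suc in simp)
  ultimately have "([:-1, 0, 1:] :: real poly) dvd F"
    using dvd_trans by blast
  then have F: "poly F 1 = 0" "poly F (-1) = 0"
    by (auto simp: dvd_def)
  \<comment> \<open>The case of a constant \<open>q\<close> is split off, since for k = 0 its
    derivative does not meet the strict degree bound of the induction hypothesis.\<close>
  have "pint (F * pderiv q) = 0"
  proof (cases "pderiv q = 0")
    case False
    then have "degree (pderiv q) < k"
      using Suc.prems by (auto simp: degree_pderiv pderiv_eq_0_iff)
    then show ?thesis
      unfolding F_def using Suc by simp
  qed simp
  moreover have "pint (pderiv (F * q)) = 0"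
    by (simp add: pint_pderiv F)
  ultimately have "pint (q * pderiv F) = 0"
    by (simp add: pderiv_mult pint_add)
  then show ?case
    by (simp add: F_def mult.commute)
qed simp

lemma legendre_orthogonal:
  "degree q < n \<Longrightarrow> pint (legendre_poly n * q) = 0"
  unfolding legendre_poly_def mult_smult_left pint_smult
  by (simp add: higher_pderiv_orthogonal)

text \<open>The factor to multiply by is the product of the linear factors at the roots of odd order.\<close>

lemma nonneg_multiple:
  fixes p :: "real poly"
  assumes "p \<noteq> 0"
  shows "\<exists>q. q \<noteq> 0 \<and> degree q \<le> card {x. poly p x = 0} \<and> (\<forall>x. 0 \<le> poly (p * q) x)"
  using assms
proof (induction "degree p" arbitrary: p rule: less_induct)
  case less
  show ?case
  proof (cases "\<exists>a. poly p a = 0")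
    case False
    \<comment> \<open>Without real roots \<open>p\<close> has constant sign, so its sign at 0 is a
      suitable multiplier.\<close>
    define q where "q = [:sgn (poly p 0):]"
    have "0 \<le> poly (p * q) x" for x
    proof (rule ccontr)
      assume neg: "\<not> 0 \<le> poly (p * q) x"
      have 0: "poly p 0 * poly p x < 0"
      proof -
        have "poly p 0 \<noteq> 0" "sgn (poly p 0) * poly p x < 0"
          using neg False by (auto simp: q_def mult.commute not_le)
        then show ?thesis
          by (auto simp: sgn_if mult_less_0_iff split: if_splits)
      qed
      then have "x \<noteq> 0" by (auto simp: mult_less_0_iff)
      then consider "x < 0" | "x > 0" by linarith
      then show False
        using 0 False poly_IVT_pos[of x 0 p] poly_IVT_neg[of x 0 p]
          poly_IVT_pos[of 0 x p] poly_IVT_neg[of 0 x p]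
        by cases (auto simp: mult_less_0_iff)
    qed
    moreover have "q \<noteq> 0" "degree q = 0"
      using False by (auto simp: q_def sgn_if)
    ultimately show ?thesis by (metis le0)
  next
    case True
    then obtain a where a: "poly p a = 0" ..
    define m where "m = order a p"
    have "m > 0"
      using a less.prems by (simp add: m_def order_gt_0_iff)
    obtain p' where p': "p = [:-a, 1:] ^ m * p'" "\<not> [:-a, 1:] dvd p'"
      using order_decomp[OF less.prems, of a] by (auto simp: m_def)
    have nz: "p' \<noteq> 0" "poly p' a \<noteq> 0"
      using p' less.prems by (auto simp: poly_eq_0_iff_dvd)
    have "degree p' < degree p"
      using nz \<open>m > 0\<close> by (simp add: p'(1) degree_mult_eq degree_power_eq)
    then obtain q' where q': "q' \<noteq> 0" "degree q' \<le> card {x. poly p' x = 0}"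
        "\<And>x. 0 \<le> poly (p' * q') x"
      using less.hyps nz by blast
    \<comment> \<open>Whatever the order m is, the number of distinct roots grows by exactly one,
      which pays for at most one extra linear factor.\<close>
    have "{x. poly p x = 0} = insert a {x. poly p' x = 0}"
      using \<open>m > 0\<close> by (auto simp: p'(1))
    then have card: "card {x. poly p x = 0} = Suc (card {x. poly p' x = 0})"
      using nz by (simp add: poly_roots_finite)
    show ?thesis
    proof (cases "even m")
      case True
      then show ?thesis
        using q' card
        by (intro exI[of _ q']) (auto simp: p'(1) zero_le_even_power mult.assoc)
    next
      case False
      \<comment> \<open>For odd m the extra factor completes (x - a)^m to an even power.\<close>
      have "0 \<le> poly (p * ([:-a, 1:] * q')) x" for x
      proof -
        have "poly (p * ([:-a, 1:] * q')) x = (x - a) ^ Suc m * poly (p' * q') x"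
          by (simp add: p'(1) algebra_simps)
        then show ?thesis
          using False q'(3)[of x] by (auto intro!: mult_nonneg_nonneg simp del: power_Suc simp: zero_le_even_power)
      qed
      moreover have "degree ([:-a, 1:] * q') \<le> card {x. poly p x = 0}"
        using q' card by (subst degree_mult_eq) auto
      moreover have "[:-a, 1:] * q' \<noteq> 0"
        using q'(1) by (metis mult_eq_0_iff one_neq_zero pCons_eq_0_iff)
      ultimately show ?thesis by blast
    qed
  qed
qed

section \<open>Gauss nodes and the degree of exactness\<close>

lemma finite_gauss_nodes: "finite (gauss_nodes n)"
  unfolding gauss_nodes_def by (rule poly_roots_finite[OF legendre_nonzero])

text \<open>With fewer than n real roots, the multiplier from \<open>nonneg_multiple\<close> would
  have degree below n. Orthogonality would then give a nonzero nonnegative polynomial the integral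
  0.\<close>

lemma card_gauss_nodes: "card (gauss_nodes n) = n"
proof (rule antisym)
  show "card (gauss_nodes n) \<le> n"
    using card_poly_roots_bound[OF legendre_nonzero[of n]] by (simp add: gauss_nodes_def legendre_degree)
  obtain q where q: "q \<noteq> 0" "degree q \<le> card (gauss_nodes n)"
      "\<And>x. 0 \<le> poly (legendre_poly n * q) x"
    using nonneg_multiple[OF legendre_nonzero[of n]] unfolding gauss_nodes_def by blast
  show "n \<le> card (gauss_nodes n)"
  proof (rule ccontr)
    assume "\<not> n \<le> card (gauss_nodes n)"
    then have "pint (legendre_poly n * q) = 0"
      using q by (intro legendre_orthogonal) simp
    then have "legendre_poly n * q = 0"
      using q(3) by (rule pint_nonneg_eq_0[rotated])
    then show False
      using q(1) legendre_nonzero by simp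
  qed
qed

definition gauss_sum :: "nat \<Rightarrow> real poly \<Rightarrow> real" where
  "gauss_sum n q = (\<Sum>x\<in>gauss_nodes n. gauss_weight n x * poly q x)"

lemma gauss_sum_add: "gauss_sum n (p + q) = gauss_sum n p + gauss_sum n q"
  by (simp add: gauss_sum_def algebra_simps sum.distrib)

lemma gauss_sum_smult: "gauss_sum n (smult c q) = c * gauss_sum n q"
  by (simp add: gauss_sum_def sum_distrib_left algebra_simps)

lemma gauss_sum_legendre: "gauss_sum n (legendre_poly n * q) = 0"
  by (simp add: gauss_sum_def gauss_nodes_def)

text \<open>The weights are integrals of the Lagrange basis polynomials \<open>l x\<close>, and
  interpolation at n distinct nodes reproduces every polynomial of degree below n.\<close>

lemma gauss_sum_interpolatory:
  assumes "degree q < n"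
  shows "gauss_sum n q = pint q"
proof -
  let ?X = "gauss_nodes n"
  define l where "l x = (\<Prod>y\<in>?X - {x}. smult (1 / (x - y)) [:-y, 1:])" for x
  have weight: "gauss_weight n x = pint (l x)" for x
    unfolding gauss_weight_def l_def
    by (rule pint_eqI[symmetric]) (simp add: poly_prod diff_divide_distrib)
  have l: "poly (l x) y = (if x = y then 1 else 0)" if "x \<in> ?X" "y \<in> ?X" for x y
  proof (cases "x = y")
    case True
    have "poly (l x) x = 1"
      unfolding l_def poly_prod
    proof (rule prod.neutral, rule ballI)
      fix z assume "z \<in> ?X - {x}"
      then have "x - z \<noteq> 0" by auto
      then show "poly (smult (1 / (x - z)) [:- z, 1:]) x = 1" by (simp flip: diff_divide_distrib)
    qed
    then show ?thesis using True by simp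
  next
    case False
    then have "\<exists>z\<in>?X - {x}. poly (smult (1 / (x - z)) [:- z, 1:]) y = 0"
      using that by (intro bexI[of _ y]) auto
    then show ?thesis
      using False finite_gauss_nodes[of n] by (simp add: l_def poly_prod prod_zero)
  qed
  have deg: "degree (l x) < n" if "x \<in> ?X" for x
  proof -
    have "degree (l x) \<le> sum (degree \<circ> (\<lambda>y. smult (1 / (x - y)) [:-y, 1:])) (?X - {x})"
      unfolding l_def by (rule degree_prod_sum_le) (simp add: finite_gauss_nodes)
    also have "\<dots> \<le> (\<Sum>y\<in>?X - {x}. 1)"
      by (rule sum_mono) simp
    also have "\<dots> = card (?X - {x})"
      by simp
    also have "\<dots> < n"
      using that card_gauss_nodes[of n] finite_gauss_nodes[of n] card_Diff1_less by metis
    finally show ?thesis .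
  qed
  have "q = (\<Sum>x\<in>?X. smult (poly q x) (l x))"
  proof (rule poly_eqI_degree[where A = ?X])
    fix y assume "y \<in> ?X"
    then show "poly q y = poly (\<Sum>x\<in>?X. smult (poly q x) (l x)) y"
      by (simp add: poly_sum l finite_gauss_nodes if_distrib cong: if_cong)
  next
    show "degree q < card ?X" by (simp add: assms card_gauss_nodes)
    show "degree (\<Sum>x\<in>?X. smult (poly q x) (l x)) < card ?X"
      unfolding card_gauss_nodes
      by (rule degree_sum_less) (use assms deg degree_smult_le le_less_trans in \<open>auto\<close>)
  qed
  then have "pint q = (\<Sum>x\<in>?X. poly q x * pint (l x))"
    by (metis (no_types, lifting) pint_sum pint_smult sum.cong)
  then show ?thesis
    by (simp add: gauss_sum_def weight mult.commute)
qed

text \<open>Divide by the Legendre polynomial. On the multiple of it the rule vanishes, the nodes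
  being its roots, and the integral vanishes by orthogonality; the remainder is interpolated
  exactly.\<close>

lemma gauss_sum_exact:
  assumes "degree q < 2 * n"
  shows "gauss_sum n q = pint q"
proof -
  let ?L = "legendre_poly n"
  have q: "q = ?L * (q div ?L) + q mod ?L"
    by simp
  have "n > 0" using assms by simp
  \<comment> \<open>A quotient of degree n or more would produce a term of degree at least 2n, which
    the remainder cannot cancel.\<close>
  have "degree (q div ?L) < n"
  proof (rule ccontr)
    assume *: "\<not> degree (q div ?L) < n"
    then have "q div ?L \<noteq> 0" using \<open>n > 0\<close> by auto
    then have "degree (?L * (q div ?L)) \<ge> 2 * n"
      using * by (simp add: degree_mult_eq legendre_nonzero legendre_degree)
    moreover have "degree (q mod ?L) < 2 * n"
      using degree_mod_less[of ?L q] legendre_nonzero legendre_degree[of n] \<open>n > 0\<close> by auto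
    ultimately have "degree q \<ge> 2 * n"
      by (metis degree_add_eq_left order_less_le_trans q)
    then show False using assms by simp
  qed
  moreover have "degree (q mod ?L) < n"
    using degree_mod_less[of ?L q] legendre_nonzero legendre_degree[of n] \<open>n > 0\<close> by auto
  ultimately show ?thesis
    by (subst (1 2) q)
       (simp only: gauss_sum_add pint_add gauss_sum_legendre legendre_orthogonal gauss_sum_interpolatory)
qed

definition gauss_power :: "nat \<Rightarrow> nat \<Rightarrow> real" where
  "gauss_power n m = (\<Sum>x\<in>gauss_nodes n. gauss_weight n x * x ^ m)"

lemma gauss_power_gauss_sum: "gauss_power n m = gauss_sum n (monom 1 m)"
  by (simp add: gauss_power_def gauss_sum_def poly_monom)

lemma gauss_power_exact: "m < 2 * n \<Longrightarrow> gauss_power n m = moment m"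
  by (simp add: gauss_power_gauss_sum moment_pint gauss_sum_exact degree_monom_eq)

text \<open>The rule vanishes on the square of the Legendre polynomial, whereas the integral does not.\<close>

lemma gauss_power_inexact:
  assumes "n > 0"
  shows "gauss_power n (2 * n) \<noteq> moment (2 * n)"
proof
  assume eq: "gauss_power n (2 * n) = moment (2 * n)"
  let ?L = "legendre_poly n"
  define c where "c = lead_coeff ?L"
  \<comment> \<open>\<open>R\<close> is the square without its leading term, so it has degree below
    2n. Exactness at x^(2n) would therefore extend to the whole square.\<close>
  define R where "R = ?L * ?L - smult (c * c) (monom 1 (2 * n))"
  have LL: "?L * ?L = R + smult (c * c) (monom 1 (2 * n))"
    by (simp add: R_def)
  have "degree R < 2 * n"
  proof (rule degree_lessI)
    show "R \<noteq> 0 \<or> 2 * n > 0" using assms by simp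
    show "\<forall>k\<ge>2 * n. coeff R k = 0"
    proof safe
      fix k assume k: "2 * n \<le> k"
      show "coeff R k = 0"
      proof (cases "k = 2 * n")
        case True
        then show ?thesis
          using coeff_mult_degree_sum[of ?L ?L] by (simp add: R_def c_def legendre_degree mult_2)
      next
        case False
        then have "coeff (?L * ?L) k = 0"
          using k degree_mult_le[of ?L ?L] by (intro coeff_eq_0) (simp add: legendre_degree)
        then show ?thesis using False by (simp add: R_def)
      qed
    qed
  qed
  then have "gauss_sum n (?L * ?L) = pint (?L * ?L)"
    using eq unfolding LL
    by (simp add: gauss_sum_add pint_add gauss_sum_smult pint_smult gauss_sum_exact
        gauss_power_gauss_sum moment_pint)
  then have "pint (?L * ?L) = 0"
    by (simp add: gauss_sum_legendre)
  then have "?L * ?L = 0"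
    by (rule pint_nonneg_eq_0[rotated]) simp
  then show False
    using legendre_nonzero by simp
qed

subsection \<open>Polynomials in three variables and the quadrature defect\<close>

lemma UNIV_3_distinct: "distinct [i, j, k] \<Longrightarrow> UNIV = {i, j, k :: 3}"
  using exhaust_3[of i] exhaust_3[of j] exhaust_3[of k] by (auto simp: UNIV_3)

lemma prod_3_distinct: "distinct [i, j, k :: 3] \<Longrightarrow> prod f UNIV = f i * f j * f k"
  by (subst UNIV_3_distinct) (auto simp: mult.assoc)

section \<open>Monomials and boxes of exponents\<close>

definition monomial :: "nat ^ 3 \<Rightarrow> real ^ 3 \<Rightarrow> real" where
  "monomial e x = (\<Prod>i\<in>UNIV. x $ i ^ e $ i)"

definition exponents :: "nat ^ 3 \<Rightarrow> (nat ^ 3) set" where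
  "exponents p = {e. \<forall>i. e $ i \<le> p $ i}"

text \<open>Two indices suffice, since the remaining coordinate takes \<open>d\<close>. Keeping the
  indices variable lets one argument serve every direction.\<close>

definition coords :: "3 \<Rightarrow> 3 \<Rightarrow> nat \<Rightarrow> nat \<Rightarrow> nat \<Rightarrow> nat ^ 3" where
  "coords i j a b d = (\<chi> l. if l = i then a else if l = j then b else d)"

lemma coords_nth:
  assumes "distinct [i, j, k]"
  shows "coords i j a b d $ i = a" "coords i j a b d $ j = b" "coords i j a b d $ k = d"
  using assms by (auto simp: coords_def)

lemma forall_3_distinct: "distinct [i, j, k :: 3] \<Longrightarrow> (\<forall>l. P l) \<longleftrightarrow> P i \<and> P j \<and> P k"
  using UNIV_3_distinct[of i j k] by (metis UNIV_I empty_iff insert_iff)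

lemma coords_surj: "distinct [i, j, k] \<Longrightarrow> coords i j (e $ i) (e $ j) (e $ k) = e"
  by (simp add: vec_eq_iff forall_3_distinct[of i j k] coords_nth[of i j k])

lemma coords_in_exponents:
  assumes "distinct [i, j, k]"
  shows "coords i j a b d \<in> exponents p \<longleftrightarrow> a \<le> p $ i \<and> b \<le> p $ j \<and> d \<le> p $ k"
  using assms by (simp add: exponents_def forall_3_distinct[OF assms] coords_nth[OF assms])

lemma exponents_eq_image:
  assumes "distinct [i, j, k]"
  shows "exponents p = (\<lambda>(a, b, d). coords i j a b d) ` ({..p $ i} \<times> {..p $ j} \<times> {..p $ k})"
proof (intro equalityI subsetI)
  fix e assume "e \<in> exponents p"
  then show "e \<in> (\<lambda>(a, b, d). coords i j a b d) ` ({..p $ i} \<times> {..p $ j} \<times> {..p $ k})"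
    by (intro image_eqI[of _ _ "(e $ i, e $ j, e $ k)"]) (simp_all add: coords_surj[OF assms] exponents_def)
qed (auto simp: coords_in_exponents[OF assms])

lemma finite_exponents [simp]: "finite (exponents p)"
  by (subst exponents_eq_image[of 1 2 3]) simp_all

lemma sum_exponents:
  assumes "distinct [i, j, k]"
  shows "(\<Sum>e\<in>exponents p. F e) = (\<Sum>a\<le>p $ i. \<Sum>b\<le>p $ j. \<Sum>d\<le>p $ k. F (coords i j a b d))"
proof -
  have "inj_on (\<lambda>(a, b, d). coords i j a b d) ({..p $ i} \<times> {..p $ j} \<times> {..p $ k})"
    by (rule inj_on_inverseI[of _ "\<lambda>e. (e $ i, e $ j, e $ k)"]) (auto simp: coords_nth[OF assms])
  then show ?thesis
    unfolding exponents_eq_image[OF assms]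
    by (subst sum.reindex) (auto simp: sum.cartesian_product intro!: sum.cong)
qed

lemma monomial_coords:
  assumes "distinct [i, j, k]"
  shows "monomial (coords i j a b d) x = x $ i ^ a * x $ j ^ b * x $ k ^ d"
  by (simp add: monomial_def prod_3_distinct[OF assms] coords_nth[OF assms])

lemma Q_space_iff: "f \<in> Q_space p \<longleftrightarrow> (\<exists>c. \<forall>x. f x = (\<Sum>e\<in>exponents p. c e * monomial e x))"
proof
  assume "f \<in> Q_space p"
  then obtain c where c: "\<And>x. f x =
      (\<Sum>a\<le>p $ 1. \<Sum>b\<le>p $ 2. \<Sum>d\<le>p $ 3. c a b d * x $ 1 ^ a * x $ 2 ^ b * x $ 3 ^ d)"
    unfolding Q_space_def by auto
  show "\<exists>c. \<forall>x. f x = (\<Sum>e\<in>exponents p. c e * monomial e x)"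
    by (rule exI[of _ "\<lambda>e. c (e $ 1) (e $ 2) (e $ 3)"])
       (simp add: c sum_exponents[of 1 2 3] monomial_coords[of 1 2 3] coords_nth[of 1 2 3] mult.assoc)
next
  assume "\<exists>c. \<forall>x. f x = (\<Sum>e\<in>exponents p. c e * monomial e x)"
  then obtain c where c: "\<And>x. f x = (\<Sum>e\<in>exponents p. c e * monomial e x)"
    by auto
  show "f \<in> Q_space p"
    unfolding Q_space_def
    by (intro CollectI exI[of _ "\<lambda>a b d. c (coords 1 2 a b d)"])
       (simp add: c sum_exponents[of 1 2 3] monomial_coords[of 1 2 3] mult.assoc)
qed

lemma Q_spaceE:
  assumes "f \<in> Q_space p"
  obtains c where "\<And>x. f x = (\<Sum>e\<in>exponents p. c e * monomial e x)"
  using assms unfolding Q_space_iff by blast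

lemma monomial_in_Q_space:
  assumes "e \<in> exponents p"
  shows "monomial e \<in> Q_space p"
  unfolding Q_space_iff
  by (rule exI[of _ "\<lambda>e'. if e' = e then 1 else 0"]) (use assms in \<open>simp add: if_distrib[of "\<lambda>c. c * _"] cong: if_cong\<close>)

section \<open>Gradients of monomials and their determinants\<close>

definition grad :: "(real ^ 3 \<Rightarrow> real) \<Rightarrow> real ^ 3 \<Rightarrow> real ^ 3" where
  "grad f x = (\<chi> j. frechet_derivative f (at x) (axis j 1))"

lemma monomial_has_derivative:
  "(monomial e has_derivative
     (\<lambda>h. \<Sum>i\<in>UNIV. real (e $ i) * h $ i * x $ i ^ (e $ i - 1) * (\<Prod>j\<in>UNIV - {i}. x $ j ^ e $ j))) (at x)"
  unfolding monomial_def
  by (intro has_derivative_prod has_derivative_power bounded_linear.has_derivative[OF bounded_linear_vec_nth] has_derivative_ident)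

text \<open>The truncated exponent for \<open>e $ i = 0\<close> does no harm, as the factor
  \<open>real (e $ i)\<close> is then zero.\<close>

lemma grad_monomial:
  "grad (monomial e) x $ i = real (e $ i) * x $ i ^ (e $ i - 1) * (\<Prod>j\<in>UNIV - {i}. x $ j ^ e $ j)"
  unfolding grad_def frechet_derivative_at[OF monomial_has_derivative, symmetric]
  by (simp add: axis_def if_distrib[of "\<lambda>c. _ * c"] if_distrib[of "\<lambda>c. c * _"] cong: if_cong)

lemma polynomial_has_derivative:
  assumes "\<And>x. f x = (\<Sum>e\<in>S. c e * monomial e x)"
  shows "(f has_derivative (\<lambda>h. \<Sum>e\<in>S. c e * frechet_derivative (monomial e) (at x) h)) (at x)"
proof -
  have f: "f = (\<lambda>x. \<Sum>e\<in>S. c e * monomial e x)"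
    using assms by (rule ext)
  have "(monomial e has_derivative frechet_derivative (monomial e) (at x)) (at x)" for e
    using differentiableI[OF monomial_has_derivative] unfolding frechet_derivative_works .
  then show ?thesis
    unfolding f by (intro has_derivative_sum has_derivative_mult_right)
qed

lemma grad_polynomial:
  assumes "\<And>x. f x = (\<Sum>e\<in>S. c e * monomial e x)"
  shows "grad f x = (\<Sum>e\<in>S. c e *\<^sub>R grad (monomial e) x)"
  unfolding vec_eq_iff
  unfolding grad_def frechet_derivative_at[OF polynomial_has_derivative[OF assms], symmetric]
  by simp

lemma Q_space_differentiable: "f \<in> Q_space p \<Longrightarrow> f differentiable (at x)"
  unfolding Q_space_iff using polynomial_has_derivative differentiableI by blast

lemma jacobian_row:
  assumes "\<And>i. (\<lambda>x. z x $ i) differentiable (at x)"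
  shows "jacobian z (at x) $ i = grad (\<lambda>x. z x $ i) x"
proof -
  let ?D = "\<lambda>h. \<chi> i. frechet_derivative (\<lambda>x. z x $ i) (at x) h"
  have "(z has_derivative ?D) (at x)"
    using assms unfolding has_derivative_componentwise_within[of z] frechet_derivative_works
    by (auto simp: Basis_vec_def inner_axis)
  then have "frechet_derivative z (at x) = ?D"
    by (rule frechet_derivative_at[symmetric])
  then show ?thesis
    by (simp add: jacobian_def matrix_def grad_def vec_eq_iff)
qed

text \<open>This is the determinant with rows a, b, c and columns in the order i, j, k, expanded
  along the first row.\<close>

definition triple :: "3 \<Rightarrow> 3 \<Rightarrow> 3 \<Rightarrow> real ^ 3 \<Rightarrow> real ^ 3 \<Rightarrow> real ^ 3 \<Rightarrow> real" where
  "triple i j k a b c = a $ i * (b $ j * c $ k - b $ k * c $ j)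
     - a $ j * (b $ i * c $ k - b $ k * c $ i) + a $ k * (b $ i * c $ j - b $ j * c $ i)"

abbreviation "det_rows \<equiv> triple 1 2 3"

text \<open>The cross product polarises the cofactor matrix, so the pairing is the full polarisation
  of the determinant: the signed terms draw the rows 1, 2, 3 from the three matrices in all possible
  ways.\<close>

lemma frobenius_cross:
  "frobenius A (matrix_cross B C) =
     det_rows (A $ 1) (B $ 2) (C $ 3) - det_rows (A $ 1) (B $ 3) (C $ 2)
   + det_rows (A $ 2) (B $ 3) (C $ 1) - det_rows (A $ 2) (B $ 1) (C $ 3)
   + det_rows (A $ 3) (B $ 1) (C $ 2) - det_rows (A $ 3) (B $ 2) (C $ 1)"
  by (simp add: frobenius_def trace_def matrix_matrix_mult_def transpose_def matrix_cross_def
      cof_def sum_3 triple_def algebra_simps)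

text \<open>Reordering columns changes a determinant only by a sign, which does not affect whether a
  defect vanishes. So the coordinates may be renamed.\<close>

lemma triple_permute:
  assumes "distinct [i, j, k]"
  obtains \<sigma> where "\<sigma> \<noteq> 0" "\<And>a b c. det_rows a b c = \<sigma> * triple i j k a b c"
proof -
  have "(\<forall>a b c. det_rows a b c = 1 * triple i j k a b c) \<or>
        (\<forall>a b c. det_rows a b c = (-1) * triple i j k a b c)"
    using assms exhaust_3[of i] exhaust_3[of j] exhaust_3[of k]
    by (elim disjE; simp add: triple_def algebra_simps)
  then show ?thesis
    using that[of 1] that[of "-1"] by auto
qed

abbreviation real_vec :: "nat ^ 3 \<Rightarrow> real ^ 3" where
  "real_vec e \<equiv> (\<chi> i. real (e $ i))"

text \<open>Every coordinate is differentiated exactly once, so each total exponent drops by one.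
  Where a total exponent is already 0, one of the numerical factors is 0 too, so truncated
  subtraction is safe.\<close>

lemma grad_monomial_mult:
  assumes "distinct [i, j, k]"
  shows "grad (monomial e1) x $ i * grad (monomial e2) x $ j * grad (monomial e3) x $ k
     = real (e1 $ i) * real (e2 $ j) * real (e3 $ k) * monomial (\<chi> l. e1 $ l + e2 $ l + e3 $ l - 1) x"
proof (cases "e1 $ i = 0 \<or> e2 $ j = 0 \<or> e3 $ k = 0")
  case True
  then show ?thesis by (auto simp: grad_monomial)
next
  case False
  then obtain a b c where abc: "e1 $ i = Suc a" "e2 $ j = Suc b" "e3 $ k = Suc c"
    by (metis not0_implies_Suc)
  have "UNIV - {i} = {j, k}" "UNIV - {j} = {i, k}" "UNIV - {k} = {i, j}"
    using assms UNIV_3_distinct[OF assms] by auto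
  then show ?thesis
    using assms by (simp add: grad_monomial monomial_def prod_3_distinct[OF assms] abc power_add)
qed

lemma det_grad_monomials:
  "det_rows (grad (monomial e1) x) (grad (monomial e2) x) (grad (monomial e3) x)
     = det_rows (real_vec e1) (real_vec e2) (real_vec e3)
       * monomial (\<chi> l. e1 $ l + e2 $ l + e3 $ l - 1) x"
proof -
  have expand: "det_rows a b c = a $ 1 * b $ 2 * c $ 3 - a $ 1 * b $ 3 * c $ 2 - a $ 2 * b $ 1 * c $ 3
     + a $ 2 * b $ 3 * c $ 1 + a $ 3 * b $ 1 * c $ 2 - a $ 3 * b $ 2 * c $ 1" for a b c
    by (simp add: triple_def algebra_simps)
  show ?thesis
    unfolding expand by (simp add: grad_monomial_mult ring_distribs)
qed

lemma triple_sum: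
  "triple i j k (\<Sum>a\<in>A. f a *\<^sub>R u a) v w = (\<Sum>a\<in>A. f a * triple i j k (u a) v w)"
  "triple i j k v (\<Sum>a\<in>A. f a *\<^sub>R u a) w = (\<Sum>a\<in>A. f a * triple i j k v (u a) w)"
  "triple i j k v w (\<Sum>a\<in>A. f a *\<^sub>R u a) = (\<Sum>a\<in>A. f a * triple i j k v w (u a))"
  by (induction A rule: infinite_finite_induct) (simp_all add: triple_def algebra_simps)

definition det_grad where
  "det_grad f g h x = det_rows (grad f x) (grad g x) (grad h x)"

lemma det_grad_expand:
  assumes "\<And>x. f x = (\<Sum>e\<in>S. c e * monomial e x)"
    "\<And>x. g x = (\<Sum>e\<in>S. c' e * monomial e x)"
    "\<And>x. h x = (\<Sum>e\<in>S. c'' e * monomial e x)"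
  shows "det_grad f g h x = (\<Sum>(e1, e2, e3)\<in>S \<times> S \<times> S. c e1 * c' e2 * c'' e3
     * det_rows (real_vec e1) (real_vec e2) (real_vec e3)
     * monomial (\<chi> l. e1 $ l + e2 $ l + e3 $ l - 1) x)"
  unfolding det_grad_def grad_polynomial[OF assms(1)] grad_polynomial[OF assms(2)]
    grad_polynomial[OF assms(3)] triple_sum(1)
  unfolding triple_sum(2)
  unfolding triple_sum(3) det_grad_monomials
  by (simp add: sum_distrib_left sum.cartesian_product split_beta mult.assoc)

section \<open>Integrals and quadrature errors\<close>

lemma continuous_monomial: "continuous_on A (monomial e)"
  unfolding monomial_def by (intro continuous_intros)

lemma continuous_det_grad:
  assumes "f \<in> Q_space p" "g \<in> Q_space p" "h \<in> Q_space p"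
  shows "continuous_on A (det_grad f g h)"
proof -
  obtain c where f: "\<And>x. f x = (\<Sum>e\<in>exponents p. c e * monomial e x)"
    using assms(1) by (rule Q_spaceE) (rule that)
  obtain c' where g: "\<And>x. g x = (\<Sum>e\<in>exponents p. c' e * monomial e x)"
    using assms(2) by (rule Q_spaceE) (rule that)
  obtain c'' where h: "\<And>x. h x = (\<Sum>e\<in>exponents p. c'' e * monomial e x)"
    using assms(3) by (rule Q_spaceE) (rule that)
  note expand = det_grad_expand[OF f g h, unfolded split_beta]
  show ?thesis
    by (rule continuous_on_eq[OF _ expand[symmetric]]) (intro continuous_intros continuous_monomial)
qed

text \<open>Fubini: \<open>lborel\<close> is a product of one-dimensional measures, and the
  indicator of the cube and the monomial both factor.\<close>

lemma integral_monomial: "integral (cbox (-1) 1) (monomial e) = (\<Prod>i\<in>UNIV. moment (e $ i))"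
proof -
  interpret product_sigma_finite "\<lambda>_ :: real ^ 3. lborel :: real measure" ..
  \<comment> \<open>The product measure is indexed by basis vectors, so the exponents are carried
    over from coordinates to these.\<close>
  define E :: "real ^ 3 \<Rightarrow> nat" where "E b = (\<Sum>i\<in>UNIV. if b = axis i 1 then e $ i else 0)" for b
  define F where "F b t = indicator {-1..1} t * (t :: real) ^ E b" for b t
  have E: "E (axis i 1) = e $ i" for i
    by (simp add: E_def axis_eq_axis)
  have prod_Basis: "(\<Prod>b\<in>Basis. G b) = (\<Prod>i\<in>UNIV. G (axis i 1))" for G :: "real ^ 3 \<Rightarrow> real"
    by (rule prod.reindex_bij_witness[of _ "\<lambda>i. axis i 1" "\<lambda>b. THE i. b = axis i 1"])
       (auto simp: Basis_vec_def axis_eq_axis)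
  have set_int: "set_integrable lborel {-1..1} (\<lambda>t :: real. t ^ m)" for m
    unfolding set_integrable_def by (rule borel_integrable_compact) (auto intro!: continuous_intros)
  have F_int: "integrable lborel (F b)" for b
    using set_int[of "E b"] by (simp add: F_def[abs_def] set_integrable_def)
  have F_val: "(\<integral>t. F b t \<partial>lborel) = moment (E b)" for b
    using set_borel_integral_eq_integral(2)[OF set_int[of "E b"]]
    by (simp add: F_def[abs_def] set_lebesgue_integral_def moment_def)
  have mono_set: "set_integrable lborel (cbox (-1) 1) (monomial e)"
    unfolding set_integrable_def
    by (rule borel_integrable_compact) (auto intro: continuous_monomial)
  have ind: "indicator (cbox (-1) 1) x *\<^sub>R monomial e x = (\<Prod>b\<in>Basis. F b (x \<bullet> b))" for x :: "real ^ 3"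
    unfolding prod_Basis F_def E monomial_def prod.distrib
    by (auto simp: indicator_def mem_box_cart inner_axis)
  have "integral (cbox (-1) 1) (monomial e) = (\<integral>x. indicator (cbox (-1) 1) x *\<^sub>R monomial e x \<partial>lborel)"
    using set_borel_integral_eq_integral(2)[OF mono_set] by (simp add: set_lebesgue_integral_def)
  also have "\<dots> = (\<integral>x. (\<Prod>b\<in>Basis. F b (x \<bullet> b)) \<partial>lborel)"
    unfolding ind ..
  also have "\<dots> = (\<integral>x. (\<Prod>b\<in>Basis. F b (x b)) \<partial>(\<Pi>\<^sub>M b\<in>Basis. lborel))"
    unfolding F_def by (subst lborel_eq, subst integral_distr) simp_all
  also have "\<dots> = (\<Prod>b\<in>Basis. moment (E b))"
    by (subst product_integral_prod) (simp_all add: F_int F_val)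
  finally show ?thesis
    by (simp add: prod_Basis E)
qed

lemma sum_product3:
  fixes f g h :: "'a \<Rightarrow> real"
  shows "(\<Sum>a\<in>A. \<Sum>b\<in>B. \<Sum>c\<in>C. f a * (g b * h c)) = (\<Sum>a\<in>A. f a) * ((\<Sum>b\<in>B. g b) * (\<Sum>c\<in>C. h c))"
  by (simp only: flip: sum_distrib_left sum_distrib_right)

lemma gauss_rule_monomial: "gauss_rule n (monomial e) = (\<Prod>i\<in>UNIV. gauss_power (n $ i) (e $ i))"
  by (simp add: gauss_rule_def monomial_def prod_3_distinct[of 1 2 3] gauss_power_def
      mult.assoc flip: sum_product3) (simp add: mult_ac)

definition quad_error :: "nat ^ 3 \<Rightarrow> (real ^ 3 \<Rightarrow> real) \<Rightarrow> real" where
  "quad_error n f = gauss_rule n f - integral (cbox (-1) 1) f"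

lemma quad_error_cmult: "quad_error n (\<lambda>x. c * f x) = c * quad_error n f"
  by (simp add: quad_error_def gauss_rule_def sum_distrib_left algebra_simps)

lemma quad_error_add:
  assumes "continuous_on UNIV f" "continuous_on UNIV g"
  shows "quad_error n (\<lambda>x. f x + g x) = quad_error n f + quad_error n g"
proof -
  have "f integrable_on cbox (-1) 1" "g integrable_on cbox (-1) 1"
    using assms by (auto intro!: integrable_continuous intro: continuous_on_subset)
  then show ?thesis
    by (simp add: quad_error_def gauss_rule_def integral_add sum.distrib algebra_simps)
qed

lemma quad_error_diff:
  assumes "continuous_on UNIV f" "continuous_on UNIV g"
  shows "quad_error n (\<lambda>x. f x - g x) = quad_error n f - quad_error n g"
proof -
  have "continuous_on UNIV (\<lambda>x. (-1) * g x)"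
    using assms by (intro continuous_intros)
  from quad_error_add[OF assms(1) this] show ?thesis
    using quad_error_cmult[of n "-1" g] by simp
qed

lemma quad_error_sum:
  assumes "\<And>a. a \<in> A \<Longrightarrow> continuous_on UNIV (f a)"
  shows "quad_error n (\<lambda>x. \<Sum>a\<in>A. c a * f a x) = (\<Sum>a\<in>A. c a * quad_error n (f a))"
  using assms
proof (induction A rule: infinite_finite_induct)
  case (insert a A)
  then show ?case
    by (simp add: quad_error_add quad_error_cmult continuous_on_sum continuous_on_mult)
qed (simp_all add: quad_error_def gauss_rule_def)

definition monomial_error :: "nat ^ 3 \<Rightarrow> nat ^ 3 \<Rightarrow> real" where
  "monomial_error n m = (\<Prod>i\<in>UNIV. gauss_power (n $ i) (m $ i)) - (\<Prod>i\<in>UNIV. moment (m $ i))"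

lemma quad_error_monomial: "quad_error n (monomial m) = monomial_error n m"
  by (simp add: quad_error_def monomial_error_def gauss_rule_monomial integral_monomial)

text \<open>By trilinearity these numbers determine the error for all triples of
  polynomials.\<close>

definition det_error :: "nat ^ 3 \<Rightarrow> nat ^ 3 \<Rightarrow> nat ^ 3 \<Rightarrow> nat ^ 3 \<Rightarrow> real" where
  "det_error n e1 e2 e3 = det_rows (real_vec e1) (real_vec e2) (real_vec e3)
     * monomial_error n (\<chi> l. e1 $ l + e2 $ l + e3 $ l - 1)"

lemma quad_error_det_grad:
  assumes "\<And>x. f x = (\<Sum>e\<in>S. c e * monomial e x)"
    "\<And>x. g x = (\<Sum>e\<in>S. c' e * monomial e x)"
    "\<And>x. h x = (\<Sum>e\<in>S. c'' e * monomial e x)"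
  shows "quad_error n (det_grad f g h)
    = (\<Sum>(e1, e2, e3)\<in>S \<times> S \<times> S. c e1 * c' e2 * c'' e3 * det_error n e1 e2 e3)"
proof -
  let ?m = "\<lambda>(e1 :: nat ^ 3, e2 :: nat ^ 3, e3 :: nat ^ 3). (\<chi> l. e1 $ l + e2 $ l + e3 $ l - 1) :: nat ^ 3"
  let ?c = "\<lambda>(e1, e2, e3). c e1 * c' e2 * c'' e3 * det_rows (real_vec e1) (real_vec e2) (real_vec e3)"
  have "det_grad f g h = (\<lambda>x. \<Sum>q\<in>S \<times> S \<times> S. ?c q * monomial (?m q) x)"
    using det_grad_expand[OF assms] by (simp add: split_beta fun_eq_iff)
  then have "quad_error n (det_grad f g h) = (\<Sum>q\<in>S \<times> S \<times> S. ?c q * quad_error n (monomial (?m q)))"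
    by (simp only: quad_error_sum continuous_monomial)
  then show ?thesis
    by (simp add: quad_error_monomial det_error_def split_beta mult.assoc)
qed

section \<open>Reduction to scalar polynomials\<close>

definition W_space :: "nat ^ 3 \<Rightarrow> nat ^ 3 \<Rightarrow> (real ^ 3 \<Rightarrow> real) set" where
  "W_space p n = {f \<in> Q_space p. \<forall>g\<in>Q_space p. \<forall>h\<in>Q_space p. quad_error n (det_grad f g h) = 0}"

text \<open>By trilinearity it is enough to test with monomials, and membership becomes a linear
  system for the coefficients of \<open>f\<close>.\<close>

lemma W_space_iff:
  assumes f: "\<And>x. f x = (\<Sum>e\<in>exponents p. c e * monomial e x)"
  shows "f \<in> W_space p n \<longleftrightarrow>
    (\<forall>e2\<in>exponents p. \<forall>e3\<in>exponents p. (\<Sum>e\<in>exponents p. c e * det_error n e e2 e3) = 0)"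
proof
  assume W: "f \<in> W_space p n"
  show "\<forall>e2\<in>exponents p. \<forall>e3\<in>exponents p. (\<Sum>e\<in>exponents p. c e * det_error n e e2 e3) = 0"
  proof safe
    fix e2 e3 assume e: "e2 \<in> exponents p" "e3 \<in> exponents p"
    have delta: "(\<Sum>a\<in>exponents p. (if a = e' then 1 else 0) * F a) = F e'"
      if "e' \<in> exponents p" for e' and F :: "nat ^ 3 \<Rightarrow> real"
    proof -
      have "(\<Sum>a\<in>exponents p. (if a = e' then 1 else 0) * F a)
          = (\<Sum>a\<in>exponents p. if a = e' then F a else 0)"
        by (rule sum.cong) auto
      then show ?thesis using that by simp
    qed
    have "0 = quad_error n (det_grad f (monomial e2) (monomial e3))"
      using W e monomial_in_Q_space unfolding W_space_def by auto
    also have "\<dots> = (\<Sum>(e, a, b)\<in>exponents p \<times> exponents p \<times> exponents p.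
        c e * (if a = e2 then 1 else 0) * (if b = e3 then 1 else 0) * det_error n e a b)"
      by (rule quad_error_det_grad) (simp_all only: f delta e)
    also have "\<dots> = (\<Sum>e\<in>exponents p. \<Sum>a\<in>exponents p. (if a = e2 then 1 else 0) *
        (\<Sum>b\<in>exponents p. (if b = e3 then 1 else 0) * (c e * det_error n e a b)))"
      by (simp only: sum_distrib_left sum.cartesian_product) (rule sum.cong, auto)
    also have "\<dots> = (\<Sum>e\<in>exponents p. c e * det_error n e e2 e3)"
      by (simp only: delta e)
    finally show "(\<Sum>e\<in>exponents p. c e * det_error n e e2 e3) = 0" by simp
  qed
next
  assume *: "\<forall>e2\<in>exponents p. \<forall>e3\<in>exponents p. (\<Sum>e\<in>exponents p. c e * det_error n e e2 e3) = 0"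
  have "quad_error n (det_grad f g h) = 0" if gQ: "g \<in> Q_space p" and hQ: "h \<in> Q_space p" for g h
  proof -
    obtain c' where g: "\<And>x. g x = (\<Sum>e\<in>exponents p. c' e * monomial e x)"
      using gQ by (rule Q_spaceE) (rule that)
    obtain c'' where h: "\<And>x. h x = (\<Sum>e\<in>exponents p. c'' e * monomial e x)"
      using hQ by (rule Q_spaceE) (rule that)
    have "quad_error n (det_grad f g h) = (\<Sum>e\<in>exponents p. \<Sum>a\<in>exponents p. \<Sum>b\<in>exponents p.
        c e * c' a * c'' b * det_error n e a b)"
      by (subst quad_error_det_grad[OF f g h]) (simp add: sum.cartesian_product)
    also have "\<dots> = (\<Sum>a\<in>exponents p. \<Sum>b\<in>exponents p. \<Sum>e\<in>exponents p.
        c e * c' a * c'' b * det_error n e a b)"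
      by (subst sum.swap, rule sum.cong[OF refl], rule sum.swap)
    also have "\<dots> = (\<Sum>a\<in>exponents p. \<Sum>b\<in>exponents p. c' a * c'' b * (\<Sum>e\<in>exponents p. c e * det_error n e a b))"
      by (simp add: sum_distrib_left mult_ac)
    finally show ?thesis using * by simp
  qed
  moreover have "f \<in> Q_space p"
    unfolding Q_space_iff using f by auto
  ultimately show "f \<in> W_space p n"
    by (simp add: W_space_def)
qed

lemma cof_integrand_det_grad:
  assumes "z \<in> fields_in (Q_space p)" "u \<in> fields_in (Q_space p)" "v \<in> fields_in (Q_space p)"
  shows "cof_integrand z u v x =
     det_grad (\<lambda>x. z x $ 1) (\<lambda>x. u x $ 2) (\<lambda>x. v x $ 3) x - det_grad (\<lambda>x. z x $ 1) (\<lambda>x. u x $ 3) (\<lambda>x. v x $ 2) x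
   + det_grad (\<lambda>x. z x $ 2) (\<lambda>x. u x $ 3) (\<lambda>x. v x $ 1) x - det_grad (\<lambda>x. z x $ 2) (\<lambda>x. u x $ 1) (\<lambda>x. v x $ 3) x
   + det_grad (\<lambda>x. z x $ 3) (\<lambda>x. u x $ 1) (\<lambda>x. v x $ 2) x - det_grad (\<lambda>x. z x $ 3) (\<lambda>x. u x $ 2) (\<lambda>x. v x $ 1) x"
proof -
  have "jacobian w (at x) $ i = grad (\<lambda>x. w x $ i) x" if "w \<in> fields_in (Q_space p)" for w i
    using that by (intro jacobian_row Q_space_differentiable) (auto simp: fields_in_def)
  then show ?thesis
    using assms by (simp add: cof_integrand_def frobenius_cross det_grad_def)
qed

lemma quadrature_defect_eq:
  fixes n :: "nat ^ 3"
  assumes "z \<in> fields_in (Q_space p)" "u \<in> fields_in (Q_space p)" "v \<in> fields_in (Q_space p)"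
  defines "T \<equiv> \<lambda>i j k. quad_error n (det_grad (\<lambda>x. z x $ i) (\<lambda>x. u x $ j) (\<lambda>x. v x $ k))"
  shows "quadrature_defect n z u v = T 1 2 3 - T 1 3 2 + T 2 3 1 - T 2 1 3 + T 3 1 2 - T 3 2 1"
proof -
  have c: "continuous_on UNIV (det_grad (\<lambda>x. z x $ i) (\<lambda>x. u x $ j) (\<lambda>x. v x $ k))" for i j k
    using assms by (intro continuous_det_grad) (auto simp: fields_in_def)
  have "quadrature_defect n z u v = quad_error n (cof_integrand z u v)"
    by (simp add: quadrature_defect_def quad_error_def)
  also have "cof_integrand z u v = (\<lambda>x.
     det_grad (\<lambda>x. z x $ 1) (\<lambda>x. u x $ 2) (\<lambda>x. v x $ 3) x - det_grad (\<lambda>x. z x $ 1) (\<lambda>x. u x $ 3) (\<lambda>x. v x $ 2) x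
   + det_grad (\<lambda>x. z x $ 2) (\<lambda>x. u x $ 3) (\<lambda>x. v x $ 1) x - det_grad (\<lambda>x. z x $ 2) (\<lambda>x. u x $ 1) (\<lambda>x. v x $ 3) x
   + det_grad (\<lambda>x. z x $ 3) (\<lambda>x. u x $ 1) (\<lambda>x. v x $ 2) x - det_grad (\<lambda>x. z x $ 3) (\<lambda>x. u x $ 2) (\<lambda>x. v x $ 1) x)"
    using cof_integrand_det_grad[OF assms(1-3)] by (rule ext)
  finally show ?thesis
    unfolding T_def by (simp add: quad_error_add quad_error_diff c continuous_on_add continuous_on_diff)
qed

lemma Q_space_0: "(\<lambda>_. 0) \<in> Q_space p"
  unfolding Q_space_iff by (rule exI[of _ "\<lambda>_. 0"]) simp

lemma det_grad_0: "det_grad f (\<lambda>_. 0) h = (\<lambda>_. 0)" "det_grad f g (\<lambda>_. 0) = (\<lambda>_. 0)"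
  by (simp_all add: det_grad_def grad_def triple_def fun_eq_iff frechet_derivative_const)

lemma quad_error_0: "quad_error n (\<lambda>_. 0) = 0"
  by (simp add: quad_error_def gauss_rule_def)

text \<open>Test fields with one nonzero component each isolate a single one of the six
  determinants, so the components of \<open>z\<close> satisfy the scalar condition
  separately.\<close>

lemma Z0_space_eq_fields_in: "Z0_space p n = fields_in (W_space p n)"
proof (intro equalityI subsetI)
  fix z assume "z \<in> fields_in (W_space p n)"
  then have z: "(\<lambda>x. z x $ i) \<in> W_space p n" for i
    by (simp add: fields_in_def)
  then have "z \<in> fields_in (Q_space p)"
    by (auto simp: fields_in_def W_space_def)
  moreover have "quadrature_defect n z u v = 0"
    if "u \<in> fields_in (Q_space p)" "v \<in> fields_in (Q_space p)" for u v
    using z that calculation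
    by (subst quadrature_defect_eq[of z p]) (auto simp: W_space_def fields_in_def)
  ultimately show "z \<in> Z0_space p n"
    by (simp add: Z0_space_def)
next
  fix z assume z: "z \<in> Z0_space p n"
  then have zQ: "z \<in> fields_in (Q_space p)"
    by (simp add: Z0_space_def)
  have "(\<lambda>x. z x $ i) \<in> W_space p n" for i
  proof -
    define unit_field :: "3 \<Rightarrow> (real ^ 3 \<Rightarrow> real) \<Rightarrow> real ^ 3 \<Rightarrow> real ^ 3"
      where "unit_field j g = (\<lambda>x. \<chi> l. if l = j then g x else 0)" for j g
    have field: "unit_field j g \<in> fields_in (Q_space p)" if "g \<in> Q_space p" for j g
    proof -
      have "(\<lambda>x. if l = j then g x else 0) \<in> Q_space p" for l
        using that Q_space_0 by (cases "l = j") auto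
      then show ?thesis
        by (simp add: fields_in_def unit_field_def)
    qed
    have comp: "(\<lambda>x. unit_field j g x $ l) = (if l = j then g else (\<lambda>_. 0))" for j g l
      by (auto simp: unit_field_def)
    \<comment> \<open>With a cyclic triple the surviving determinant carries the positive
      sign.\<close>
    obtain j k :: 3 where jk: "(i, j, k) \<in> {(1, 2, 3), (2, 3, 1), (3, 1, 2)}"
      using exhaust_3[of i] by auto
    have "quad_error n (det_grad (\<lambda>x. z x $ i) g h) = 0" if gh: "g \<in> Q_space p" "h \<in> Q_space p" for g h
    proof -
      have "quadrature_defect n z (unit_field j g) (unit_field k h) = 0"
        using z field gh unfolding Z0_space_def by blast
      then show ?thesis
        using jk quadrature_defect_eq[OF zQ field[OF gh(1), of j] field[OF gh(2), of k], of n]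
        by (auto simp: comp det_grad_0 quad_error_0)
    qed
    then show ?thesis
      using zQ by (auto simp: W_space_def fields_in_def)
  qed
  then show "z \<in> fields_in (W_space p n)"
    by (simp add: fields_in_def)
qed

subsection \<open>Conditions on the coefficients of highest degree\<close>

lemma coeff_poly_sum:
  fixes G :: "nat \<Rightarrow> 'a :: comm_semiring_1"
  shows "coeff (\<Sum>u\<le>N. monom (G u) u) w = (if w \<le> N then G w else 0)"
  by (simp add: coeff_sum coeff_monom)

lemma pint_monom: "pint (monom c m) = c * moment m"
  using pint_smult[of c "monom 1 m"] by (simp add: smult_monom moment_pint)

lemma pint_poly_sum_mult_monom:
  "pint ((\<Sum>u\<le>N. monom (c u) u) * monom 1 t) = (\<Sum>u\<le>N. c u * moment (u + t))"
  by (simp add: sum_distrib_right mult_monom pint_sum pint_monom)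

lemma pint_pderiv_poly_sum_mult_monom:
  "pint (pderiv (\<Sum>u\<le>N. monom (c u) u) * monom 1 t) = (\<Sum>u\<le>N. real u * c u * moment (u + t - 1))"
proof -
  have "pint (pderiv (\<Sum>u\<le>N. monom (c u) u) * monom 1 t) = (\<Sum>u\<le>N. real u * c u * moment (u - 1 + t))"
    by (simp add: higher_pderiv_sum[of 1, simplified] pderiv_monom sum_distrib_right mult_monom pint_sum pint_monom)
  \<comment> \<open>The two exponents can differ only for u = 0, where the factor u
    vanishes.\<close>
  also have "\<dots> = (\<Sum>u\<le>N. real u * c u * moment (u + t - 1))"
    by (rule sum.cong) (auto simp: not_less_eq_eq gr0_conv_Suc)
  finally show ?thesis .
qed

text \<open>For a fixed sum \<open>t\<close> of the two exponents the hypothesis is affine in \<open>\<alpha>\<close>. As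
  \<open>2 \<le> P\<close>, two values of \<open>\<alpha>\<close> are admissible whenever \<open>1 \<le> t \<le> P + 1\<close>.\<close>

lemma bilinear_moments_imp_0:
  fixes m k :: "real poly"
  assumes deg: "degree m \<le> P" "degree k \<le> P" and "2 \<le> P" and pos: "0 < s" "0 < a" "0 < b"
    and test: "\<And>\<alpha> \<beta>. \<alpha> \<le> P \<Longrightarrow> \<beta> \<le> P \<Longrightarrow> \<alpha> + \<beta> \<le> P + 1 \<Longrightarrow>
      s * real \<alpha> * pint (m * monom 1 (\<alpha> + \<beta> - 1)) - a * pint (pderiv m * monom 1 (\<alpha> + \<beta>))
      + (a * real \<beta> - b * real \<alpha>) * pint (k * monom 1 (\<alpha> + \<beta> - 1)) = 0"
  shows "m = 0 \<and> k = 0"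
proof -
  define M where "M j = pint (m * monom 1 j)" for j
  define K where "K j = pint (k * monom 1 j)" for j
  define D where "D t = pint (pderiv m * monom 1 t)" for t
  have MK: "s * M t = (a + b) * K t" "D (Suc t) = Suc t * K t" if "t \<le> P" for t
  proof -
    \<comment> \<open>The pairs used are (x, t + 1 - x) and (x + 1, t - x). For t = P the choice x =
      0 would give the inadmissible second exponent P + 1, hence the shift to 1.\<close>
    define x where "x = (if t = P then 1 else 0 :: nat)"
    have "s * real x * M t - a * D (Suc t) + (a * real (Suc t - x) - b * real x) * K t = 0"
      "s * real (Suc x) * M t - a * D (Suc t) + (a * real (t - x) - b * real (Suc x)) * K t = 0"
      using test[of x "Suc t - x"] test[of "Suc x" "t - x"] that \<open>2 \<le> P\<close>
      by (auto simp: x_def M_def K_def D_def split: if_splits)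
    moreover have "x \<le> t"
      using \<open>2 \<le> P\<close> by (auto simp: x_def)
    ultimately have 1: "s * x * M t - a * D (Suc t) + (a * (Suc t - real x) - b * x) * K t = 0"
      and 2: "s * (1 + real x) * M t - a * D (Suc t) + (a * (t - real x) - b * (1 + real x)) * K t = 0"
      by (simp_all add: of_nat_diff algebra_simps)
    \<comment> \<open>Subtracting the two conditions isolates the slope in \<alpha>.\<close>
    have "s * M t - (a + b) * K t = (s * (1 + real x) * M t - a * D (Suc t) + (a * (t - real x) - b * (1 + real x)) * K t)
       - (s * x * M t - a * D (Suc t) + (a * (Suc t - real x) - b * x) * K t)"
      by (simp add: algebra_simps)
    then show eq: "s * M t = (a + b) * K t"
      using 1 2 by simp
    have "a * (D (Suc t) - Suc t * K t) = real x * (s * M t - (a + b) * K t)"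
      using 1 by (simp add: algebra_simps)
    then show "D (Suc t) = Suc t * K t"
      using eq pos by simp
  qed
  define e where "e = poly m 1"
  \<comment> \<open>The exponents \<alpha> = \<beta> = 0 show that \<open>m\<close> has equal values
    at both end points.\<close>
  have "D 0 = 0"
    using test[of 0 0] pos by (simp add: D_def)
  then have e': "poly m (-1) = e"
    using pint_pderiv[of m] by (simp add: D_def e_def)
  have "smult s m - smult (a + b) k = 0"
  proof (rule pint_orthogonal_imp_0[where n = P])
    show "degree (smult s m - smult (a + b) k) \<le> P"
      using deg by (intro degree_diff_le order_trans[OF degree_smult_le])
  next
    fix j assume "j \<le> P"
    then show "pint ((smult s m - smult (a + b) k) * monom 1 j) = 0"
      using MK(1)[of j] by (simp add: left_diff_distrib pint_diff pint_smult M_def K_def)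
  qed
  then have sm: "smult s m = smult (a + b) k" by simp
  \<comment> \<open>Integration by parts expresses D (j + 1) + (j + 1) M j through the common end
    value \<open>e\<close>. As D (j + 1) = (j + 1) K j, all moments of k + m agree with those of the
    constant \<open>e\<close>.\<close>
  have "k + m - [:e:] = 0"
  proof (rule pint_orthogonal_imp_0[where n = P])
    show "degree (k + m - [:e:]) \<le> P"
      using deg by (intro degree_diff_le degree_add_le) auto
  next
    fix j assume j: "j \<le> P"
    have "pderiv (m * monom 1 (Suc j)) = pderiv m * monom 1 (Suc j) + smult (Suc j) (m * monom 1 j)"
      by (simp add: pderiv_mult pderiv_monom smult_monom mult.commute flip: mult_smult_right)
    then have "e - e * (-1) ^ Suc j = D (Suc j) + Suc j * M j"
      using pint_pderiv[of "m * monom 1 (Suc j)"] e'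
      by (simp add: pint_add pint_smult D_def M_def poly_monom e_def)
    moreover have "Suc j * moment j = 1 - (-1) ^ Suc j"
      by (simp add: moment_eq)
    ultimately have "e * (Suc j * moment j) = Suc j * (K j + M j)"
      using MK(2)[OF j] by (simp only: right_diff_distrib distrib_left mult_1_right)
    then have "K j + M j - e * moment j = 0"
      by (simp add: mult.left_commute)
    then show "pint ((k + m - [:e:]) * monom 1 j) = 0"
      by (simp add: ring_distribs pint_diff pint_add M_def K_def pint_monom smult_monom)
  qed
  then have km: "k = [:e:] - m"
    by (simp add: algebra_simps)
  \<comment> \<open>At the point 1 the relation k = e - m gives k(1) = 0, because m(1) = e.\<close>
  have "s * e = 0"
    using arg_cong[OF sm, of "\<lambda>q. poly q 1"] by (simp add: km e_def)
  then have "e = 0" using pos by simp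
  then have "smult (s + (a + b)) m = 0"
    using sm by (simp add: km smult_add_left)
  then have "m = 0"
    using pos by simp
  then show ?thesis
    using km \<open>e = 0\<close> by simp
qed

lemma monomial_error_exact:
  assumes "\<And>l. m $ l < 2 * n $ l"
  shows "monomial_error n m = 0"
  using assms by (simp add: monomial_error_def gauss_power_exact)

text \<open>The test monomials are chosen so that the degree in coordinate \<open>i\<close> exceeds the degree of
  exactness only for the top coefficients of \<open>f\<close>, and the degrees in the other coordinates never do.\<close>

lemma W_space_top_coeffs:
  assumes W: "f \<in> W_space p n" and f: "\<And>x. f x = (\<Sum>e\<in>exponents p. c e * monomial e x)"
    and pn: "\<forall>i. p $ i + 1 \<le> n $ i" and d: "distinct [i, j, k]"
    and s: "s \<le> p $ i" and ab: "a + b + s = 2 * n $ i + 1"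
    and top: "\<And>e. e \<in> exponents p \<Longrightarrow> s < e $ i \<Longrightarrow> c e = 0"
    and le: "a \<le> p $ i" "b \<le> p $ i" "\<alpha> \<le> p $ j" "\<beta> \<le> p $ j" "\<gamma> \<le> p $ k" "\<delta> \<le> p $ k"
      "\<alpha> + \<beta> \<le> p $ j + 2" "\<gamma> + \<delta> \<le> p $ k + 2"
  shows "(\<Sum>u\<le>p $ j. \<Sum>v\<le>p $ k. c (coords i j s u v)
     * (real s * (real \<alpha> * real \<delta> - real \<gamma> * real \<beta>) - real u * (real a * real \<delta> - real \<gamma> * real b)
        + real v * (real a * real \<beta> - real \<alpha> * real b))
     * (moment (u + \<alpha> + \<beta> - 1) * moment (v + \<gamma> + \<delta> - 1))) = 0"
proof -
  let ?e2 = "coords i j a \<alpha> \<gamma>" and ?e3 = "coords i j b \<beta> \<delta>"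
  obtain \<sigma> where \<sigma>: "\<sigma> \<noteq> 0" "\<And>a b c. det_rows a b c = \<sigma> * triple i j k a b c"
    using triple_permute[OF d] by metis
  \<comment> \<open>The error of the one-dimensional rule at its first inexact degree; being
    nonzero, it can be divided out.\<close>
  define \<omega> where "\<omega> = gauss_power (n $ i) (2 * n $ i) - moment (2 * n $ i)"
  have "n $ i > 0" using pn by (metis add_gr_0 less_le_trans zero_less_one)
  then have "\<omega> \<noteq> 0"
    using gauss_power_inexact[of "n $ i"] by (simp add: \<omega>_def)
  define X where "X u v = c (coords i j s u v)
     * (real s * (real \<alpha> * real \<delta> - real \<gamma> * real \<beta>) - real u * (real a * real \<delta> - real \<gamma> * real b)
        + real v * (real a * real \<beta> - real \<alpha> * real b))
     * (moment (u + \<alpha> + \<beta> - 1) * moment (v + \<gamma> + \<delta> - 1))" for u v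
  \<comment> \<open>The bounds on \<alpha> + \<beta> and \<gamma> + \<delta> keep these degrees at
    most 2 p + 1, below 2 n.\<close>
  have exact: "gauss_power (n $ j) (u + \<alpha> + \<beta> - 1) = moment (u + \<alpha> + \<beta> - 1)" if "u \<le> p $ j" for u
    using pn[rule_format, of j] that le by (intro gauss_power_exact) linarith
  have exact': "gauss_power (n $ k) (v + \<gamma> + \<delta> - 1) = moment (v + \<gamma> + \<delta> - 1)" if "v \<le> p $ k" for v
    using pn[rule_format, of k] that le by (intro gauss_power_exact) linarith
  \<comment> \<open>Below s everything is integrated exactly, and above s the coefficients vanish,
    so only the slice q = s contributes.\<close>
  have summand: "c (coords i j q u v) * det_error n (coords i j q u v) ?e2 ?e3
      = (if q = s then \<sigma> * \<omega> * X u v else 0)"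
    if q: "q \<le> p $ i" "u \<le> p $ j" "v \<le> p $ k" for q u v
  proof -
    let ?m = "\<chi> l. coords i j q u v $ l + ?e2 $ l + ?e3 $ l - 1"
    have err: "monomial_error n ?m = (gauss_power (n $ i) (q + a + b - 1) - moment (q + a + b - 1))
        * (moment (u + \<alpha> + \<beta> - 1) * moment (v + \<gamma> + \<delta> - 1))"
      by (simp add: monomial_error_def prod_3_distinct[OF d] coords_nth[OF d] left_diff_distrib mult.assoc
          exact[OF q(2), simplified] exact'[OF q(3), simplified])
    have det: "det_rows (real_vec (coords i j q u v)) (real_vec ?e2) (real_vec ?e3)
        = \<sigma> * (real q * (real \<alpha> * real \<delta> - real \<gamma> * real \<beta>) - real u * (real a * real \<delta> - real \<gamma> * real b)
        + real v * (real a * real \<beta> - real \<alpha> * real b))"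
      unfolding \<sigma>(2) by (simp add: triple_def coords_nth[OF d])
    consider "q < s" | "q = s" | "q > s" by linarith
    then show ?thesis
    proof cases
      case 1
      then have "gauss_power (n $ i) (q + a + b - 1) = moment (q + a + b - 1)"
        using ab \<open>n $ i > 0\<close> by (intro gauss_power_exact) linarith
      then show ?thesis
        unfolding det_error_def err using 1 by simp
    next
      case 2
      then have "q + a + b - 1 = 2 * n $ i" using ab by linarith
      then show ?thesis
        unfolding det_error_def err det using 2 by (simp add: X_def \<omega>_def)
    next
      case 3
      then show ?thesis
        using top[of "coords i j q u v"] q by (simp add: coords_in_exponents[OF d] coords_nth[OF d])
    qed
  qed
  have "?e2 \<in> exponents p" "?e3 \<in> exponents p"
    using le by (simp_all add: coords_in_exponents[OF d])
  then have "0 = (\<Sum>e\<in>exponents p. c e * det_error n e ?e2 ?e3)"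
    using W_space_iff[OF f] W by simp
  also have "\<dots> = (\<Sum>q\<le>p $ i. \<Sum>u\<le>p $ j. \<Sum>v\<le>p $ k. if q = s then \<sigma> * \<omega> * X u v else 0)"
    unfolding sum_exponents[OF d] by (intro sum.cong refl summand) auto
  also have "\<dots> = (\<Sum>q\<le>p $ i. if q = s then \<sigma> * \<omega> * (\<Sum>u\<le>p $ j. \<Sum>v\<le>p $ k. X u v) else 0)"
    by (rule sum.cong) (auto simp: sum_distrib_left)
  also have "\<dots> = \<sigma> * \<omega> * (\<Sum>u\<le>p $ j. \<Sum>v\<le>p $ k. X u v)"
    using s by simp
  finally have "(\<Sum>u\<le>p $ j. \<Sum>v\<le>p $ k. X u v) = 0"
    using \<sigma>(1) \<open>\<omega> \<noteq> 0\<close> by simp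
  then show ?thesis
    by (simp add: X_def)
qed

text \<open>Write x, y, z for the directions i, j, k. The test pairs are x^a y^\<alpha> and x^b
  y^\<beta> z^\<gamma>. For fixed \<gamma>, integrating out z leaves two polynomials in y, to which
  \<open>bilinear_moments_imp_0\<close> applies; varying \<gamma> then recovers the
  coefficients.\<close>

lemma W_space_top_coeffs_0:
  assumes W: "f \<in> W_space p n" and f: "\<And>x. f x = (\<Sum>e\<in>exponents p. c e * monomial e x)"
    and p: "\<forall>i. 1 \<le> p $ i" and pn: "\<forall>i. p $ i + 1 \<le> n $ i" and d: "distinct [i, j, k]"
    and pj: "2 \<le> p $ j"
    and s: "s \<le> p $ i" "2 * (n $ i - p $ i) < s"
    and top: "\<And>e. e \<in> exponents p \<Longrightarrow> s < e $ i \<Longrightarrow> c e = 0"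
    and uv: "u \<le> p $ j" "v \<le> p $ k"
  shows "c (coords i j s u v) = 0"
proof -
  define C where "C u v = c (coords i j s u v)" for u v
  \<comment> \<open>With \<open>a\<close> maximal, \<open>b\<close> is forced by a + b + s = 2 n +
    1. The lower bound on s gives \<open>b \<le> p $ i\<close>, and s \<le> p < n makes
    \<open>b\<close> positive.\<close>
  define a where "a = p $ i"
  define b where "b = 2 * n $ i + 1 - s - p $ i"
  have ni: "p $ i + 1 \<le> n $ i" using pn by simp
  have ab: "a + b + s = 2 * n $ i + 1" "a \<le> p $ i" "b \<le> p $ i" "0 < a" "0 < b" "0 < s"
    using s ni by (auto simp: a_def b_def)
  \<comment> \<open>For the z-polynomial multiplying x^s y^u, \<open>m'\<close> is its integral
    against the derivative of z^\<gamma>, and \<open>h'\<close> is the integral of its derivative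
    against z^\<gamma>.\<close>
  define m' where "m' \<gamma> u = (\<Sum>v\<le>p $ k. C u v * real \<gamma> * moment (v + \<gamma> - 1))" for \<gamma> u
  define h' where "h' \<gamma> u = (\<Sum>v\<le>p $ k. C u v * real v * moment (v + \<gamma> - 1))" for \<gamma> u
  define m where "m \<gamma> = (\<Sum>u\<le>p $ j. monom (m' \<gamma> u) u)" for \<gamma>
  define h where "h \<gamma> = (\<Sum>u\<le>p $ j. monom (h' \<gamma> u) u)" for \<gamma>
  have mh: "m \<gamma> = 0 \<and> h \<gamma> = 0" if \<gamma>: "\<gamma> \<le> p $ k" for \<gamma>
  proof (rule bilinear_moments_imp_0[OF _ _ pj])
    show "degree (m \<gamma>) \<le> p $ j" "degree (h \<gamma>) \<le> p $ j"
      unfolding m_def h_def by (auto intro!: degree_sum_le order_trans[OF degree_monom_le])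
    show "0 < real s" "0 < real a" "0 < real b"
      using ab by auto
    fix \<alpha> \<beta> :: nat assume le: "\<alpha> \<le> p $ j" "\<beta> \<le> p $ j" "\<alpha> + \<beta> \<le> p $ j + 1"
    define t where "t = \<alpha> + \<beta>"
    \<comment> \<open>The truncated differences agree except possibly for t = 0; then \<alpha> =
      \<beta> = 0 and the affected coefficients are zero.\<close>
    have red: "x * moment (u + (t - 1)) = x * moment (u + t - 1)" if "t = 0 \<Longrightarrow> x = 0" for u x
      using that by (cases t) auto
    have "real s * real \<alpha> * pint (m \<gamma> * monom 1 (t - 1)) - real a * pint (pderiv (m \<gamma>) * monom 1 t)
        + (real a * real \<beta> - real b * real \<alpha>) * pint (h \<gamma> * monom 1 (t - 1))
      = (\<Sum>u\<le>p $ j. real s * real \<alpha> * m' \<gamma> u * moment (u + (t - 1))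
         - real a * real u * m' \<gamma> u * moment (u + t - 1)
         + (real a * real \<beta> - real b * real \<alpha>) * h' \<gamma> u * moment (u + (t - 1)))"
      unfolding m_def h_def pint_poly_sum_mult_monom pint_pderiv_poly_sum_mult_monom
      by (simp add: sum_distrib_left sum.distrib sum_subtractf mult.assoc)
    also have "\<dots> = (\<Sum>u\<le>p $ j. real s * real \<alpha> * m' \<gamma> u * moment (u + t - 1)
         - real a * real u * m' \<gamma> u * moment (u + t - 1)
         + (real a * real \<beta> - real b * real \<alpha>) * h' \<gamma> u * moment (u + t - 1))"
      by (intro sum.cong refl arg_cong2[where f = plus] arg_cong2[where f = minus] red) (auto simp: t_def)
    also have "\<dots> = (\<Sum>u\<le>p $ j. \<Sum>v\<le>p $ k. C u v
       * (real s * (real \<alpha> * real \<gamma> - real 0 * real \<beta>) - real u * (real a * real \<gamma> - real 0 * real b)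
          + real v * (real a * real \<beta> - real \<alpha> * real b))
       * (moment (u + \<alpha> + \<beta> - 1) * moment (v + 0 + \<gamma> - 1)))"
      unfolding m'_def h'_def
      by (rule sum.cong) (simp_all add: sum_distrib_left sum_distrib_right sum.distrib[symmetric] sum_subtractf[symmetric] t_def algebra_simps)
    also have "\<dots> = 0"
      unfolding C_def
      by (rule W_space_top_coeffs[OF W f pn d s(1) ab(1) top ab(2,3)]) (use le \<gamma> in auto)
    finally show "real s * real \<alpha> * pint (m \<gamma> * monom 1 (\<alpha> + \<beta> - 1)) - real a * pint (pderiv (m \<gamma>) * monom 1 (\<alpha> + \<beta>))
        + (real a * real \<beta> - real b * real \<alpha>) * pint (h \<gamma> * monom 1 (\<alpha> + \<beta> - 1)) = 0"
      by (simp add: t_def)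
  qed
  \<comment> \<open>\<open>\<psi>\<close> multiplies x^s y^u. The vanishing of all
    \<open>h \<gamma>\<close> makes its derivative orthogonal to every power up to
    \<open>p $ k\<close>, so \<open>\<psi>\<close> is constant; the vanishing of \<open>m 1\<close>
    gives it mean zero.\<close>
  define \<psi> where "\<psi> = (\<Sum>v\<le>p $ k. monom (C u v) v)"
  have "pderiv \<psi> = 0"
  proof (rule pint_orthogonal_imp_0[where n = "p $ k"])
    have "degree \<psi> \<le> p $ k"
      unfolding \<psi>_def by (auto intro!: degree_sum_le order_trans[OF degree_monom_le])
    then show "degree (pderiv \<psi>) \<le> p $ k"
      by (simp add: degree_pderiv)
  next
    fix \<gamma> assume "\<gamma> \<le> p $ k"
    then have "coeff (h \<gamma>) u = 0" using mh by simp
    then show "pint (pderiv \<psi> * monom 1 \<gamma>) = 0"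
      using uv unfolding h_def coeff_poly_sum h'_def \<psi>_def pint_pderiv_poly_sum_mult_monom by (simp add: mult_ac)
  qed
  then obtain q where q: "\<psi> = [:q:]"
    by (metis degree_eq_zeroE pderiv_eq_0_iff)
  have "coeff (m 1) u = 0"
    using mh[of 1] p by simp
  then have "pint (\<psi> * monom 1 0) = 0"
    using uv unfolding m_def coeff_poly_sum m'_def \<psi>_def pint_poly_sum_mult_monom by simp
  then have "q * 2 = 0"
    using pint_monom[of q 0] by (simp add: q moment_even monom_0)
  then have "coeff \<psi> v = 0"
    using q by simp
  then show ?thesis
    using uv unfolding \<psi>_def coeff_poly_sum by (simp add: C_def)
qed

text \<open>Descending induction on the degree in direction i: the coefficients of higher degree are
  already zero when a slice is treated.\<close>

lemma W_space_degree_bound: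
  assumes W: "f \<in> W_space p n" and f: "\<And>x. f x = (\<Sum>e\<in>exponents p. c e * monomial e x)"
    and p: "\<forall>i. 1 \<le> p $ i" and pn: "\<forall>i. p $ i + 1 \<le> n $ i" and d: "distinct [i, j, k]"
    and pj: "2 \<le> p $ j"
  shows "e \<in> exponents p \<Longrightarrow> 2 * (n $ i - p $ i) < e $ i \<Longrightarrow> c e = 0"
proof (induction "p $ i - e $ i" arbitrary: e rule: less_induct)
  case less
  have le: "e $ l \<le> p $ l" for l
    using less.prems by (simp add: exponents_def)
  have "c e' = 0" if "e' \<in> exponents p" "e $ i < e' $ i" for e'
  proof (rule less.hyps)
    have "e' $ i \<le> p $ i"
      using that by (simp add: exponents_def)
    then show "p $ i - e' $ i < p $ i - e $ i"
      using that by linarith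
  qed (use that less.prems in auto)
  from W_space_top_coeffs_0[OF W f p pn d pj le less.prems(2) this le le] show ?case
    by (simp add: coords_surj[OF d])
qed

subsection \<open>The kernel of the defect\<close>

lemma W_space_subset_Q_space: "W_space p n \<subseteq> Q_space p"
  by (auto simp: W_space_def)

text \<open>Each term of the linear system vanishes on its own. This criterion suits spaces spanned
  by monomials, such as the kernels below.\<close>

lemma W_spaceI:
  assumes "\<And>x. f x = (\<Sum>e\<in>exponents p. c e * monomial e x)"
    and "\<And>e e2 e3. e \<in> exponents p \<Longrightarrow> c e \<noteq> 0 \<Longrightarrow> e2 \<in> exponents p \<Longrightarrow> e3 \<in> exponents p \<Longrightarrow>
      det_error n e e2 e3 = 0"
  shows "f \<in> W_space p n"
  unfolding W_space_iff[OF assms(1)]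
  by (intro ballI sum.neutral) (use assms(2) in \<open>simp, blast\<close>)

text \<open>The determinant has degree one less than the total in every coordinate, so a total of 2
  n is still integrated exactly.\<close>

lemma det_error_exact:
  assumes "\<And>l. 0 < n $ l" "\<And>l. e1 $ l + e2 $ l + e3 $ l \<le> 2 * n $ l"
  shows "det_error n e1 e2 e3 = 0"
proof -
  have "e1 $ l + e2 $ l + e3 $ l - 1 < 2 * n $ l" for l
    using assms(1)[of l] assms(2)[of l] by linarith
  then show ?thesis
    by (simp add: det_error_def monomial_error_exact)
qed

lemma third_coordinate:
  assumes "i \<noteq> j"
  obtains k :: 3 where "distinct [i, j, k]"
proof -
  have "card {i, j} < card (UNIV :: 3 set)"
    by (simp add: card_insert_if)
  then obtain k where "k \<notin> {i, j}"
    by (metis UNIV_eq_I less_irrefl)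
  then show ?thesis
    using assms by (intro that[of k]) auto
qed

text \<open>If an exponent is too large in direction i, a second direction of order at least two
  serves as j in \<open>W_space_degree_bound\<close>. Conversely 2 (n - p) + p + p = 2 n, so the
  smaller space stays within exactness.\<close>

lemma W_space_eq_Q_space:
  assumes p: "\<forall>i. 1 \<le> p $ i" and pn: "\<forall>i. p $ i + 1 \<le> n $ i"
    and two: "2 \<le> card {i. 2 \<le> p $ i}"
  shows "W_space p n = Q_space (\<chi> i. min (p $ i) (2 * (n $ i - p $ i)))" (is "_ = Q_space ?r")
proof (intro equalityI subsetI)
  have sub: "exponents ?r \<subseteq> exponents p"
    by (auto simp: exponents_def)
  {
    fix f assume W: "f \<in> W_space p n"
    then have "f \<in> Q_space p"
      using W_space_subset_Q_space by blast
    then obtain c where f: "\<And>x. f x = (\<Sum>e\<in>exponents p. c e * monomial e x)"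
      by (rule Q_spaceE) (rule that)
    have "c e = 0" if e: "e \<in> exponents p" "e \<notin> exponents ?r" for e
    proof -
      obtain i where "\<not> e $ i \<le> ?r $ i"
        using e(2) unfolding exponents_def by blast
      moreover have "e $ i \<le> p $ i"
        using e(1) by (simp add: exponents_def)
      ultimately have i: "2 * (n $ i - p $ i) < e $ i"
        by simp
      have "\<not> {i. 2 \<le> p $ i} \<subseteq> {i}"
        using two card_mono[of "{i}" "{i. 2 \<le> p $ i}"] by auto
      then obtain j where j: "2 \<le> p $ j" "i \<noteq> j"
        by auto
      obtain k where "distinct [i, j, k]"
        using third_coordinate[OF j(2)] .
      then show ?thesis
        using W_space_degree_bound[OF W f p pn _ j(1) e(1) i] by blast
    qed
    then have "f x = (\<Sum>e\<in>exponents ?r. c e * monomial e x)" for x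
      unfolding f by (intro sum.mono_neutral_right sub) auto
    then show "f \<in> Q_space ?r"
      unfolding Q_space_iff by blast
  next
    fix f assume "f \<in> Q_space ?r"
    then obtain c where c: "\<And>x. f x = (\<Sum>e\<in>exponents ?r. c e * monomial e x)"
      by (rule Q_spaceE) (rule that)
    show "f \<in> W_space p n"
    proof (rule W_spaceI)
      show "f x = (\<Sum>e\<in>exponents p. (if e \<in> exponents ?r then c e else 0) * monomial e x)" for x
        unfolding c by (intro sum.mono_neutral_cong_left sub) auto
    next
      fix e e2 e3
      assume e: "e \<in> exponents p" "(if e \<in> exponents ?r then c e else 0) \<noteq> 0"
        "e2 \<in> exponents p" "e3 \<in> exponents p"
      then have e1: "e \<in> exponents ?r"
        by (auto split: if_splits)
      show "det_error n e e2 e3 = 0"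
      proof (rule det_error_exact)
        fix l
        show "0 < n $ l"
          using pn[rule_format, of l] by linarith
        have "e $ l \<le> 2 * (n $ l - p $ l)" "e2 $ l \<le> p $ l" "e3 $ l \<le> p $ l"
          using e e1 by (auto simp: exponents_def)
        then show "e $ l + e2 $ l + e3 $ l \<le> 2 * n $ l"
          using pn[rule_format, of l] by linarith
      qed
    qed
  }
qed

text \<open>Total degrees are at most 3, whereas 2 n is at least 4.\<close>

lemma W_space_trilinear:
  assumes p: "\<forall>i. p $ i = 1" and pn: "\<forall>i. p $ i + 1 \<le> n $ i"
  shows "W_space p n = Q_space p"
proof (intro equalityI W_space_subset_Q_space subsetI)
  fix f assume "f \<in> Q_space p"
  then obtain c where c: "\<And>x. f x = (\<Sum>e\<in>exponents p. c e * monomial e x)"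
    by (rule Q_spaceE) (rule that)
  show "f \<in> W_space p n"
  proof (rule W_spaceI[OF c], rule det_error_exact)
    fix e e2 e3 l
    assume "e \<in> exponents p" "e2 \<in> exponents p" "e3 \<in> exponents p"
    then have "e $ l \<le> 1" "e2 $ l \<le> 1" "e3 $ l \<le> 1"
      using p by (simp_all add: exponents_def)
    then show "0 < n $ l" "e $ l + e2 $ l + e3 $ l \<le> 2 * n $ l"
      using p pn[rule_format, of l] by auto
  qed
qed

text \<open>Within \<open>exponents p\<close> for orders one in directions j and k, these index the
  monomials spanning K. The cap min(p, r + 1) comes from that intersection.\<close>

definition K_exponents :: "3 \<Rightarrow> 3 \<Rightarrow> 3 \<Rightarrow> nat \<Rightarrow> (nat ^ 3) set" where
  "K_exponents i j k r = {e. e $ i \<le> r \<or> e $ i = r + 1 \<and> e $ j = 1 \<and> e $ k = 1}"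

lemma poly_eq_sum_upto:
  fixes q :: "'a :: comm_semiring_1 poly"
  assumes "degree q \<le> N"
  shows "poly q x = (\<Sum>s\<le>N. coeff q s * x ^ s)"
  unfolding poly_altdef by (rule sum.mono_neutral_left) (use assms in \<open>auto simp: coeff_eq_0\<close>)

text \<open>The exponents in directions j and k select one of 1, y, z, yz, so \<open>f\<close>
  amounts to four univariate polynomials, whose degree bounds say which coefficients vanish.\<close>

lemma K_space_iff:
  fixes p :: "nat ^ 3" and m :: nat
  assumes d: "distinct [i, j, k]" and p: "p $ j = 1" "p $ k = 1"
  defines "r \<equiv> min (p $ i) (2 * (m - p $ i))"
  shows "f \<in> K_space i j k (p $ i) m \<longleftrightarrow>
    (\<exists>c. (\<forall>e\<in>exponents p - K_exponents i j k r. c e = 0) \<and> (\<forall>x. f x = (\<Sum>e\<in>exponents p. c e * monomial e x)))"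
proof
  assume "f \<in> K_space i j k (p $ i) m"
  then obtain g h where f: "f = (\<lambda>x. g x + h x)"
    and g: "g \<in> K_affine i j k r" and h: "h \<in> K_bilinear i j k (min (p $ i) (r + 1))"
    unfolding K_space_def Let_def r_def by blast
  obtain q0 qj qk where q: "degree q0 \<le> r" "degree qj \<le> r" "degree qk \<le> r"
      "\<And>x. g x = poly q0 (x $ i) + poly qj (x $ i) * x $ j + poly qk (x $ i) * x $ k"
    using g unfolding K_affine_def by blast
  obtain q1 where q1: "degree q1 \<le> min (p $ i) (r + 1)" "\<And>x. h x = poly q1 (x $ i) * (x $ j * x $ k)"
    using h unfolding K_bilinear_def by blast
  have "r \<le> p $ i" by (simp add: r_def)
  then have deg: "degree q0 \<le> p $ i" "degree qj \<le> p $ i" "degree qk \<le> p $ i" "degree q1 \<le> p $ i"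
    using q q1 by auto
  define c where "c e = coeff (if e $ j = 0 then if e $ k = 0 then q0 else qk
      else if e $ k = 0 then qj else q1) (e $ i)" for e :: "nat ^ 3"
  have "f x = (\<Sum>e\<in>exponents p. c e * monomial e x)" for x
    by (simp add: f q(4) q1(2) sum_exponents[OF d] p c_def coords_nth[OF d] monomial_coords[OF d]
        deg[THEN poly_eq_sum_upto] sum.distrib sum_distrib_right mult.assoc)
  moreover have "c e = 0" if "e \<in> exponents p - K_exponents i j k r" for e
  proof -
    have "e $ j \<le> 1" "e $ k \<le> 1" "r < e $ i" "e $ j = 1 \<Longrightarrow> e $ k = 1 \<Longrightarrow> r + 1 < e $ i"
      using that p by (auto simp: exponents_def K_exponents_def dest: spec[of _ j] spec[of _ k])
    then show ?thesis
      using q q1 by (auto simp: c_def intro!: coeff_eq_0)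
  qed
  ultimately show "\<exists>c. (\<forall>e\<in>exponents p - K_exponents i j k r. c e = 0) \<and>
      (\<forall>x. f x = (\<Sum>e\<in>exponents p. c e * monomial e x))"
    by blast
next
  assume "\<exists>c. (\<forall>e\<in>exponents p - K_exponents i j k r. c e = 0) \<and>
      (\<forall>x. f x = (\<Sum>e\<in>exponents p. c e * monomial e x))"
  then obtain c where c: "\<And>e. e \<in> exponents p \<Longrightarrow> e \<notin> K_exponents i j k r \<Longrightarrow> c e = 0"
    and f: "\<And>x. f x = (\<Sum>e\<in>exponents p. c e * monomial e x)"
    by blast
  define q where "q u v = (\<Sum>s\<le>p $ i. monom (c (coords i j s u v)) s)" for u v
  have poly_q: "poly (q u v) t = (\<Sum>s\<le>p $ i. c (coords i j s u v) * t ^ s)" for u v t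
    by (simp add: q_def poly_sum poly_monom)
  have c0: "c (coords i j s u v) = 0"
    if "s \<le> p $ i" "u \<le> 1" "v \<le> 1" "r < s" "u = 0 \<or> v = 0 \<or> r + 1 < s" for s u v
    by (rule c) (use that p in \<open>auto simp: coords_in_exponents[OF d] K_exponents_def coords_nth[OF d]\<close>)
  have deg: "degree (q u v) \<le> N"
    if "\<And>s. s \<le> p $ i \<Longrightarrow> N < s \<Longrightarrow> c (coords i j s u v) = 0" for u v N
    unfolding q_def by (rule degree_le) (simp add: coeff_poly_sum that)
  have "degree (q 0 0) \<le> r"
    by (rule deg) (rule c0, auto)
  moreover have "degree (q 1 0) \<le> r"
    by (rule deg) (rule c0, auto)
  moreover have "degree (q 0 1) \<le> r"
    by (rule deg) (rule c0, auto)
  moreover have "degree (q 1 1) \<le> min (p $ i) (r + 1)"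
    by (rule deg) (rule c0, auto simp: min_less_iff_disj)
  moreover have "f x = (poly (q 0 0) (x $ i) + poly (q 1 0) (x $ i) * x $ j + poly (q 0 1) (x $ i) * x $ k)
      + poly (q 1 1) (x $ i) * (x $ j * x $ k)" for x
    by (simp add: f sum_exponents[OF d] p monomial_coords[OF d] poly_q sum.distrib sum_distrib_right mult.assoc)
  ultimately show "f \<in> K_space i j k (p $ i) m"
    unfolding K_space_def Let_def r_def[symmetric] K_affine_def K_bilinear_def
    by (intro CollectI exI[of _ "\<lambda>x. poly (q 0 0) (x $ i) + poly (q 1 0) (x $ i) * x $ j + poly (q 0 1) (x $ i) * x $ k"]
        exI[of _ "\<lambda>x. poly (q 1 1) (x $ i) * (x $ j * x $ k)"]) blast
qed

text \<open>The coefficient of x^s is a combination of 1, y, z, yz, and parity of the moments lets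
  each test pair see just one of them. The test for yz carries the factor a - b, which is zero
  exactly for s = 2 (n - p) + 1.\<close>

lemma W_space_top_bilinear:
  assumes W: "f \<in> W_space p n" and f: "\<And>x. f x = (\<Sum>e\<in>exponents p. c e * monomial e x)"
    and pn: "\<forall>i. p $ i + 1 \<le> n $ i" and d: "distinct [i, j, k]" and p1: "p $ j = 1" "p $ k = 1"
    and s: "s \<le> p $ i" "2 * (n $ i - p $ i) < s"
    and top: "\<And>e. e \<in> exponents p \<Longrightarrow> s < e $ i \<Longrightarrow> c e = 0"
  shows "c (coords i j s 0 0) = 0" "c (coords i j s 0 1) = 0" "c (coords i j s 1 0) = 0"
    "2 * (n $ i - p $ i) + 1 < s \<Longrightarrow> c (coords i j s 1 1) = 0"
proof -
  define a where "a = p $ i"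
  define b where "b = 2 * n $ i + 1 - s - p $ i"
  have ni: "p $ i + 1 \<le> n $ i" using pn by simp
  have ab: "a + b + s = 2 * n $ i + 1" "a \<le> p $ i" "b \<le> p $ i" "0 < a" "0 < s"
    using s ni by (auto simp: a_def b_def)
  note test = W_space_top_coeffs[OF W f pn d s(1) ab(1) top ab(2,3), unfolded p1]
  show "c (coords i j s 0 1) = 0"
    \<comment> \<open>The pair x^a and x^b y.\<close>
    using test[of 0 1 0 0] ab by (simp add: moment_odd moment_even)
  show "c (coords i j s 1 0) = 0"
    \<comment> \<open>The pair x^a and x^b z.\<close>
    using test[of 0 0 0 1] ab by (simp add: moment_odd moment_even)
  show "c (coords i j s 0 0) = 0"
    \<comment> \<open>The pair x^a y and x^b z; the determinant leaves the factor s.\<close>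
    using test[of 1 0 0 1] ab by (simp add: moment_odd moment_even)
  show "c (coords i j s 1 1) = 0" if "2 * (n $ i - p $ i) + 1 < s"
  proof -
    have "b < a" using that ab ni by (auto simp: a_def)
    then show ?thesis
      \<comment> \<open>The pair x^a y and x^b y.\<close>
      using test[of 1 1 0 0] ab by (simp add: moment_odd moment_even)
  qed
qed

text \<open>On the exponents of degree \<open>r + 1\<close> the rule fails only against two test monomials of full
  degree; then either the defect vanishes by parity or the determinant has two equal rows.\<close>

lemma det_error_K_exponents:
  assumes pn: "\<forall>i. p $ i + 1 \<le> n $ i" and d: "distinct [i, j, k]" and p1: "p $ j = 1" "p $ k = 1"
    and e: "e \<in> exponents p" "e \<in> K_exponents i j k (min (p $ i) (2 * (n $ i - p $ i)))"
      "e2 \<in> exponents p" "e3 \<in> exponents p"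
  shows "det_error n e e2 e3 = 0"
proof -
  have n0: "0 < n $ l" for l
    using pn[rule_format, of l] by linarith
  have le: "e $ l \<le> p $ l" "e2 $ l \<le> p $ l" "e3 $ l \<le> p $ l" for l
    using e by (simp_all add: exponents_def)
  have ni: "p $ i + 1 \<le> n $ i" and nj: "2 \<le> n $ j" "2 \<le> n $ k"
    using pn[rule_format, of i] pn[rule_format, of j] pn[rule_format, of k] p1 by auto
  show ?thesis
  proof (cases "e $ i + e2 $ i + e3 $ i \<le> 2 * n $ i")
    case True
    moreover have "e $ j + e2 $ j + e3 $ j \<le> 2 * n $ j" "e $ k + e2 $ k + e3 $ k \<le> 2 * n $ k"
      using le[of j] le[of k] p1 nj by auto
    ultimately have "\<forall>l. e $ l + e2 $ l + e3 $ l \<le> 2 * n $ l"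
      unfolding forall_3_distinct[OF d] by blast
    then show ?thesis
      by (intro det_error_exact n0) blast
  next
    case False
    \<comment> \<open>The total in direction i is at most 2 (n - p) + 1 + 2 p = 2 n + 1, so
      exceeding 2 n forces equality in every bound.\<close>
    then have full: "e2 $ i = p $ i" "e3 $ i = p $ i" and e1: "e $ j = 1" "e $ k = 1"
      using e(2) le[of i] ni by (auto simp: K_exponents_def)
    show ?thesis
    proof (cases "e2 = e3")
      case True
      then show ?thesis by (simp add: det_error_def triple_def)
    next
      case False
      then have "\<not> (\<forall>l. e2 $ l = e3 $ l)"
        by (simp add: vec_eq_iff)
      then consider "e2 $ j \<noteq> e3 $ j" | "e2 $ k \<noteq> e3 $ k"
        unfolding forall_3_distinct[OF d] using full by auto
      \<comment> \<open>Two different exponents in {0, 1} add up to 1, so the monomial is linear in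
        that direction, and both the rule and the integral give zero.\<close>
      then have "\<exists>l\<in>{j, k}. e $ l + e2 $ l + e3 $ l - 1 = 1"
        using le[of j] le[of k] p1 e1 by cases force+
      then obtain l where l: "l \<in> {j, k}" "e $ l + e2 $ l + e3 $ l - 1 = 1"
        by blast
      have "moment 1 = 0" "gauss_power (n $ l) 1 = 0"
        using n0[of l] by (simp_all add: moment_odd gauss_power_exact)
      then have "monomial_error n m = 0" if "m $ l = 1" for m
        using that prod_zero[of UNIV "\<lambda>i. gauss_power (n $ i) (m $ i)"]
          prod_zero[of UNIV "\<lambda>i. moment (m $ i)"]
        unfolding monomial_error_def by (metis UNIV_I diff_self finite)
      then have "monomial_error n (\<chi> l. e $ l + e2 $ l + e3 $ l - 1) = 0"
        using l(2) by simp
      then show ?thesis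
        by (simp add: det_error_def)
    qed
  qed
qed

text \<open>Descending induction on the degree in direction i, as for the general bound, now with
  the four separate tests of \<open>W_space_top_bilinear\<close>.\<close>

lemma W_space_eq_K_space:
  assumes pn: "\<forall>i. p $ i + 1 \<le> n $ i" and d: "distinct [i, j, k]" and p1: "p $ j = 1" "p $ k = 1"
  shows "W_space p n = K_space i j k (p $ i) (n $ i)"
proof (intro equalityI subsetI)
  define r where "r = min (p $ i) (2 * (n $ i - p $ i))"
  {
    fix f assume W: "f \<in> W_space p n"
    then have "f \<in> Q_space p"
      using W_space_subset_Q_space by blast
    then obtain c where f: "\<And>x. f x = (\<Sum>e\<in>exponents p. c e * monomial e x)"
      by (rule Q_spaceE) (rule that)
    have "c e = 0" if "e \<in> exponents p" "e \<notin> K_exponents i j k r" for e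
      using that
    proof (induction "p $ i - e $ i" arbitrary: e rule: less_induct)
      case less
      have le: "e $ l \<le> p $ l" for l
        using less.prems by (simp add: exponents_def)
      have r: "r < e $ i" "2 * (n $ i - p $ i) < e $ i"
        using less.prems(2) le[of i] by (auto simp: K_exponents_def r_def)
      have top: "c e' = 0" if "e' \<in> exponents p" "e $ i < e' $ i" for e'
      proof (rule less.hyps)
        have "e' $ i \<le> p $ i"
          using that by (simp add: exponents_def)
        then show "p $ i - e' $ i < p $ i - e $ i"
          using that by linarith
        \<comment> \<open>A degree above \<open>e $ i\<close> exceeds r + 1, so even the yz
          exponents there lie outside.\<close>
        show "e' \<notin> K_exponents i j k r"
          using that r by (auto simp: K_exponents_def)
      qed (use that in auto)
      note zero = W_space_top_bilinear[OF W f pn d p1 le r(2) top]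
      have e: "e = coords i j (e $ i) (e $ j) (e $ k)"
        by (simp add: coords_surj[OF d])
      have "e $ j \<le> 1" "e $ k \<le> 1"
        using le[of j] le[of k] p1 by auto
      then consider "e $ j = 0" "e $ k = 0" | "e $ j = 0" "e $ k = 1" | "e $ j = 1" "e $ k = 0"
        | "e $ j = 1" "e $ k = 1"
        by linarith
      then show ?case
      proof cases
        case 4
        then have "2 * (n $ i - p $ i) + 1 < e $ i"
          using less.prems(2) r le[of i] by (auto simp: K_exponents_def r_def)
        then show ?thesis
          using zero(4) 4 e by metis
      qed (use zero(1-3) e in metis)+
    qed
    then show "f \<in> K_space i j k (p $ i) (n $ i)"
      unfolding K_space_iff[OF d p1] r_def[symmetric] using f by blast
  next
    fix f assume "f \<in> K_space i j k (p $ i) (n $ i)"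
    then obtain c where c: "\<forall>e\<in>exponents p - K_exponents i j k r. c e = 0"
      and f: "\<And>x. f x = (\<Sum>e\<in>exponents p. c e * monomial e x)"
      unfolding K_space_iff[OF d p1] r_def[symmetric] by blast
    show "f \<in> W_space p n"
    proof (rule W_spaceI[OF f])
      fix e e2 e3
      assume e: "e \<in> exponents p" "c e \<noteq> 0" "e2 \<in> exponents p" "e3 \<in> exponents p"
      then have "e \<in> K_exponents i j k r"
        using c by blast
      then show "det_error n e e2 e3 = 0"
        using det_error_K_exponents[OF pn d p1] e unfolding r_def by blast
    qed
  }
qed

text \<open>This is the directness of the sum defining K: at (y, z) = (0, 0), (1, 0), (0, 1) the
  term yz vanishes, which forces all three polynomials of the affine part to be zero.\<close>

lemma K_affine_Int_K_bilinear:
  assumes d: "distinct [i, j, k]"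
  shows "K_affine i j k r \<inter> K_bilinear i j k m = {\<lambda>_. 0}"
proof (intro equalityI subsetI)
  fix f assume f: "f \<in> K_affine i j k r \<inter> K_bilinear i j k m"
  then obtain a b c where a: "\<And>x. f x = poly a (x $ i) + poly b (x $ i) * x $ j + poly c (x $ i) * x $ k"
    unfolding K_affine_def by blast
  obtain q where q: "\<And>x. f x = poly q (x $ i) * (x $ j * x $ k)"
    using f unfolding K_bilinear_def by blast
  have "poly a t = 0 \<and> poly b t = 0 \<and> poly c t = 0" for t
  proof -
    define y where "y u v = (\<chi> l. if l = i then t else if l = j then u else (v :: real))" for u v
    have y: "y u v $ i = t" "y u v $ j = u" "y u v $ k = v" for u v
      using d by (auto simp: y_def)
    show ?thesis
      using a[of "y 0 0"] q[of "y 0 0"] a[of "y 1 0"] q[of "y 1 0"] a[of "y 0 1"] q[of "y 0 1"]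
      by (simp add: y)
  qed
  then show "f \<in> {\<lambda>_. 0}"
    using a by auto
next
  fix f :: "real ^ 3 \<Rightarrow> real" assume "f \<in> {\<lambda>_. 0}"
  then show "f \<in> K_affine i j k r \<inter> K_bilinear i j k m"
    unfolding K_affine_def K_bilinear_def by (auto intro!: exI[of _ 0])
qed

theorem theorem4:
  fixes p n :: "nat ^ 3"
  assumes "\<forall>i. 1 \<le> p $ i"
    and "\<forall>i. p $ i + 1 \<le> n $ i"
  shows "(2 \<le> card {i. 2 \<le> p $ i} \<longrightarrow>
            Z0_space p n = fields_in (Q_space (\<chi> i. min (p $ i) (2 * (n $ i - p $ i))))) \<and>
         (\<forall>i j k. distinct [i, j, k] \<and> 2 \<le> p $ i \<and> p $ j = 1 \<and> p $ k = 1 \<longrightarrow>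
            Z0_space p n = fields_in (K_space i j k (p $ i) (n $ i)) \<and>
            (let r = min (p $ i) (2 * (n $ i - p $ i)) in
              K_affine i j k r \<inter> K_bilinear i j k (min (p $ i) (r + 1)) = {\<lambda>_. 0})) \<and>
         ((\<forall>i. p $ i = 1) \<longrightarrow> Z0_space p n = fields_in (Q_space p))"
proof (intro conjI impI allI)
  assume "2 \<le> card {i. 2 \<le> p $ i}"
  then show "Z0_space p n = fields_in (Q_space (\<chi> i. min (p $ i) (2 * (n $ i - p $ i))))"
    by (simp add: Z0_space_eq_fields_in W_space_eq_Q_space[OF assms])
next
  fix i j k
  assume ijk: "distinct [i, j, k] \<and> 2 \<le> p $ i \<and> p $ j = 1 \<and> p $ k = 1"
  show "Z0_space p n = fields_in (K_space i j k (p $ i) (n $ i))"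
    using ijk W_space_eq_K_space[OF assms(2), of i j k] unfolding Z0_space_eq_fields_in by metis
  show "let r = min (p $ i) (2 * (n $ i - p $ i)) in
      K_affine i j k r \<inter> K_bilinear i j k (min (p $ i) (r + 1)) = {\<lambda>_. 0}"
    unfolding Let_def by (rule K_affine_Int_K_bilinear) (use ijk in blast)
next
  assume "\<forall>i. p $ i = 1"
  then show "Z0_space p n = fields_in (Q_space p)"
    using W_space_trilinear[OF _ assms(2)] unfolding Z0_space_eq_fields_in by metis
qed

end
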